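(* Let $z$ be any fluid limit and fix $t\ge0$. Assume that $\sum_{j\in V_i}z_j(t)>0$ for all $i=1,\dots,K$. Then, for every $i$ (almost surely), $z_i$ is differentiable at the point $t$ if $t>0$, and has a right derivative at $t$ if $t=0$. Moreover, this (right) derivative satisfies $$z_i'(t)=\lambda_i-\varphi_i(t)\,e^{-\sum_{j\in V_i}\varphi_j(t)},\qquad\text{where }\ \varphi_i(t)=\frac{z_i(t)}{\sum_{j\in V_i}z_j(t)}.$$
   Context: Model (general, not necessarily symmetric). $\mathcal G=(\mathcal V,\mathcal E)$ is a connected undirected graph with finite vertex set $\mathcal V=\{1,\dots,K\}$. For $i\in\mathcal V$, $V_i=\{i\}\cup\{j\in\mathcal V:(i,j)\in\mathcal E\}$ is the closed neighbourhood of $i$. Time is slotted, $n=0,1,2,\dots$. The arrival vectors $A(n)=(A_1(n),\dots,A_K(n))\in\mathbb N^K$ (with $\mathbb N=\{0,1,2,\dots\}$) form an i.i.d. sequence in $n$ (coordinates may be dependent), with $\mathbf E A_i(n)=\lambda_i\in(0,\infty)$. $W_i(n)$ is the number of users at vertex $i$ at time $n$. Given $W(n)$, the numbers $N_i(n)$ of users attempting transmission are independent over $i$, $N_i(n)$ being binomial with parameters $\bigl(W_i(n),1/\sum_{j\in V_i}W_j(n)\bigr)$ (and $N_i(n)=0$ if $W_i(n)=0$), and $$W_i(n)=W_i(n-1)+A_i(n)-\mathbf 1\{N_i(n-1)=1\}\prod_{j\in V_i\setminus\{i\}}\mathbf 1\{N_j(n-1)=0\}.$$ $W^x$ denotes this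 Markov chain on $\mathbb N^K$ with $W(0)=x$; the chains $W^x$, $x\in\mathbb N^K$, are defined on a common probability space and driven by the same arrivals. Fluid limits. $|x|=\sum_{k=1}^K|x_k|$ for $x\in\mathbb R^K$. For a sequence $x^n\in\mathbb N^K$ with $|x^n|\to\infty$ put $X^n(t)=W^{x^n}(\lceil|x^n|t\rceil)/|x^n|$, $t\ge0$. A fluid limit is any accumulation point $z$, in the Skorokhod topology on $\mathbb R^K$-valued c\`adl\`ag functions on $[0,\infty)$, of such a sequence $(X^n)$ (almost surely $(X^n)$ has compact closure). Fluid limits are a.s. Lipschitz continuous, satisfy $|z(0)|=1$ and $z_i(t)\ge0$, and may be random. *)

theory Defs
  imports "HOL-Probability.Probability"
begin

section \<open>The Skorokhod topology on functions on the half-line\<close>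

text \<open>
  Functions on $[0,\infty)$ are represented by total functions on the reals; their values at
  negative arguments play no role below.
\<close>

definition cadlag :: "(real \<Rightarrow> 'a::topological_space) \<Rightarrow> bool" where
  "cadlag f \<longleftrightarrow>
     (\<forall>t\<ge>0. (f \<longlongrightarrow> f t) (at_right t)) \<and> (\<forall>t>0. \<exists>l. (f \<longlongrightarrow> l) (at_left t))"

text \<open>Increasing bijections of $[0,\infty)$ (hence homeomorphisms of $[0,\infty)$ fixing $0$).\<close>

definition time_change :: "(real \<Rightarrow> real) \<Rightarrow> bool" where
  "time_change \<mu> \<longleftrightarrow> strict_mono_on {0..} \<mu> \<and> bij_betw \<mu> {0..} {0..}"

definition skorokhod_nbhd ::
    "(real \<Rightarrow> 'a::metric_space) \<Rightarrow> real \<Rightarrow> real \<Rightarrow> (real \<Rightarrow> 'a) set" where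
  "skorokhod_nbhd f T \<epsilon> =
     {g. \<exists>\<mu> \<delta>. time_change \<mu> \<and> \<delta> < \<epsilon> \<and>
           (\<forall>s\<ge>0. \<bar>\<mu> s - s\<bar> \<le> \<delta>) \<and> (\<forall>s\<in>{0..T}. dist (g (\<mu> s)) (f s) \<le> \<delta>)}"

text \<open>
  On the cadlag functions this is the usual (J1) Skorokhod topology: there, \<open>g n\<close> converges to
  \<open>f\<close> iff there are time changes \<open>\<mu> n\<close> with
  $\sup_{s \ge 0} |\mu_n(s) - s| \to 0$ and $\sup_{s \le T} d(g_n(\mu_n(s)), f(s)) \to 0$ for
  all $T$ (Jacod and Shiryaev, Limit Theorems for Stochastic Processes, VI.1.14).  The topology
  is put on all functions because the rescaled paths below, being of the form
  $t \mapsto w(\lceil rt \rceil)/r$, are left- rather than right-continuous step functions;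
  with the cadlag functions as the whole space they would not belong to it.
\<close>

definition skorokhod_topology :: "(real \<Rightarrow> 'a::metric_space) topology" where
  "skorokhod_topology =
     topology_generated_by {skorokhod_nbhd f T \<epsilon> | f T \<epsilon>. 0 < T \<and> 0 < \<epsilon>}"

lemma skorokhod_nbhd_self: "0 < \<epsilon> \<Longrightarrow> f \<in> skorokhod_nbhd f T \<epsilon>"
  unfolding skorokhod_nbhd_def time_change_def
  by (auto intro!: exI[of _ "\<lambda>s. s"] exI[of _ 0] simp: strict_mono_on_def bij_betw_def)

lemma skorokhod_nbhd_mono:
  assumes "T' \<le> T" "\<epsilon> \<le> \<epsilon>'"
  shows "skorokhod_nbhd f T \<epsilon> \<subseteq> skorokhod_nbhd f T' \<epsilon>'"
proof
  fix g assume "g \<in> skorokhod_nbhd f T \<epsilon>"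
  then obtain \<mu> \<delta> where "time_change \<mu>" "\<delta> < \<epsilon>" "\<forall>s\<ge>0. \<bar>\<mu> s - s\<bar> \<le> \<delta>"
      "\<forall>s\<in>{0..T}. dist (g (\<mu> s)) (f s) \<le> \<delta>"
    unfolding skorokhod_nbhd_def by blast
  then show "g \<in> skorokhod_nbhd f T' \<epsilon>'"
    using assms unfolding skorokhod_nbhd_def
    by (intro CollectI exI[of _ \<mu>] exI[of _ \<delta>]) auto
qed

lemma time_change_comp:
  assumes "time_change \<mu>" "time_change \<nu>"
  shows "time_change (\<mu> \<circ> \<nu>)"
proof -
  have "\<nu> s \<in> {0..}" if "s \<in> {0..}" for s
    using assms(2) that by (auto simp: time_change_def bij_betw_def)
  then show ?thesis
    using assms unfolding time_change_def
    by (auto intro: bij_betw_trans simp: strict_mono_on_def)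
qed

lemma skorokhod_nbhd_interior:
  assumes "g \<in> skorokhod_nbhd f T \<epsilon>" "0 < T"
  shows "\<exists>T'>0. \<exists>\<epsilon>'>0. skorokhod_nbhd g T' \<epsilon>' \<subseteq> skorokhod_nbhd f T \<epsilon>"
proof -
  obtain \<mu> \<delta> where \<mu>: "time_change \<mu>" "\<delta> < \<epsilon>" "\<And>s. s \<ge> 0 \<Longrightarrow> \<bar>\<mu> s - s\<bar> \<le> \<delta>"
      "\<And>s. s \<in> {0..T} \<Longrightarrow> dist (g (\<mu> s)) (f s) \<le> \<delta>"
    using assms(1) unfolding skorokhod_nbhd_def by blast
  have \<delta>: "0 \<le> \<delta>" using \<mu>(3)[of 0] by linarith
  have pos: "0 \<le> \<mu> s" if "0 \<le> s" for s
    using \<mu>(1) that by (auto simp: time_change_def bij_betw_def)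
  have "skorokhod_nbhd g (T + \<delta>) (\<epsilon> - \<delta>) \<subseteq> skorokhod_nbhd f T \<epsilon>"
  proof
    fix h assume "h \<in> skorokhod_nbhd g (T + \<delta>) (\<epsilon> - \<delta>)"
    then obtain \<nu> \<eta> where \<nu>: "time_change \<nu>" "\<eta> < \<epsilon> - \<delta>"
        "\<And>s. s \<ge> 0 \<Longrightarrow> \<bar>\<nu> s - s\<bar> \<le> \<eta>"
        "\<And>s. s \<in> {0..T + \<delta>} \<Longrightarrow> dist (h (\<nu> s)) (g s) \<le> \<eta>"
      unfolding skorokhod_nbhd_def by blast
    have "\<bar>(\<nu> \<circ> \<mu>) s - s\<bar> \<le> \<eta> + \<delta>" if "s \<ge> 0" for s
      using \<mu>(3)[OF that] \<nu>(3)[OF pos[OF that]] by (simp add: abs_le_iff)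
    moreover have "dist (h ((\<nu> \<circ> \<mu>) s)) (f s) \<le> \<eta> + \<delta>" if s: "s \<in> {0..T}" for s
    proof -
      have "\<mu> s \<in> {0..T + \<delta>}"
        using \<mu>(3)[of s] pos[of s] s by (simp add: abs_le_iff)
      then show ?thesis
        using \<nu>(4)[of "\<mu> s"] \<mu>(4)[OF s] dist_triangle[of "h (\<nu> (\<mu> s))" "f s" "g (\<mu> s)"]
        by simp
    qed
    ultimately show "h \<in> skorokhod_nbhd f T \<epsilon>"
      using time_change_comp[OF \<nu>(1) \<mu>(1)] \<nu>(2) unfolding skorokhod_nbhd_def
      by (intro CollectI exI[of _ "\<nu> \<circ> \<mu>"] exI[of _ "\<eta> + \<delta>"]) auto
  qed
  then show ?thesis using \<mu>(2) \<delta> assms(2)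
    by (intro exI[of _ "T + \<delta>"] exI[of _ "\<epsilon> - \<delta>"] conjI) auto
qed

lemma openin_skorokhod_topology:
  "openin skorokhod_topology U \<longleftrightarrow>
     (\<forall>f\<in>U. \<exists>T>0. \<exists>\<epsilon>>0. skorokhod_nbhd f T \<epsilon> \<subseteq> U)" (is "?L \<longleftrightarrow> ?R")
proof
  assume ?L
  then have "generate_topology_on {skorokhod_nbhd f T \<epsilon> | f T \<epsilon>. 0 < T \<and> 0 < \<epsilon>} U"
    unfolding skorokhod_topology_def by (rule openin_topology_generated_by)
  then show ?R
  proof induction
    case Empty
    then show ?case by simp
  next
    case (Int U V)
    show ?case
    proof
      fix f assume "f \<in> U \<inter> V"
      then obtain T \<epsilon> T' \<epsilon>' where *: "T > 0" "\<epsilon> > 0" "T' > 0" "\<epsilon>' > 0"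
          "skorokhod_nbhd f T \<epsilon> \<subseteq> U" "skorokhod_nbhd f T' \<epsilon>' \<subseteq> V"
        using Int.IH by blast
      then have "skorokhod_nbhd f (max T T') (min \<epsilon> \<epsilon>') \<subseteq> U \<inter> V"
        using skorokhod_nbhd_mono[of T "max T T'" "min \<epsilon> \<epsilon>'" \<epsilon> f]
          skorokhod_nbhd_mono[of T' "max T T'" "min \<epsilon> \<epsilon>'" \<epsilon>' f] by auto
      with * show "\<exists>T>0. \<exists>\<epsilon>>0. skorokhod_nbhd f T \<epsilon> \<subseteq> U \<inter> V"
        by (intro exI[of _ "max T T'"] exI[of _ "min \<epsilon> \<epsilon>'"] conjI) auto
    qed
  next
    case (UN \<U>)
    show ?case
    proof
      fix f assume "f \<in> \<Union>\<U>"
      then obtain U where U: "U \<in> \<U>" "f \<in> U" by blast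
      then obtain T \<epsilon> where "T > 0" "\<epsilon> > 0" "skorokhod_nbhd f T \<epsilon> \<subseteq> U"
        using UN.IH by blast
      with U(1) show "\<exists>T>0. \<exists>\<epsilon>>0. skorokhod_nbhd f T \<epsilon> \<subseteq> \<Union>\<U>" by blast
    qed
  next
    case (Basis S)
    then obtain g T \<epsilon> where S: "S = skorokhod_nbhd g T \<epsilon>" "0 < T" by blast
    show ?case
      unfolding S(1) using skorokhod_nbhd_interior[OF _ S(2)] by (intro ballI)
  qed
next
  assume R: ?R
  show ?L
  proof (subst openin_subopen, intro ballI)
    fix f assume "f \<in> U"
    then obtain T \<epsilon> where "T > 0" "\<epsilon> > 0" "skorokhod_nbhd f T \<epsilon> \<subseteq> U"
      using R by blast
    moreover from this have "openin skorokhod_topology (skorokhod_nbhd f T \<epsilon>)"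
      unfolding skorokhod_topology_def by (intro topology_generated_by_Basis) blast
    ultimately show "\<exists>S. openin skorokhod_topology S \<and> f \<in> S \<and> S \<subseteq> U"
      using skorokhod_nbhd_self by blast
  qed
qed

definition accumulation_point :: "'a topology \<Rightarrow> (nat \<Rightarrow> 'a) \<Rightarrow> 'a \<Rightarrow> bool" where
  "accumulation_point T X z \<longleftrightarrow>
     z \<in> topspace T \<and> (\<forall>U. openin T U \<and> z \<in> U \<longrightarrow> (\<exists>\<^sub>F n in sequentially. X n \<in> U))"

section \<open>The random access model\<close>

text \<open>The vertex set $\{1,\dots,K\}$ is the finite type \<open>'k\<close>.\<close>

definition nbhd :: "('k \<times> 'k) set \<Rightarrow> 'k \<Rightarrow> 'k set" where
  "nbhd E i = insert i {j. (i, j) \<in> E}"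

text \<open>
  \<open>users E A N x n\<close> is $W^x(n)$, where \<open>A n\<close> is the arrival vector of slot \<open>n\<close> and
  \<open>N x n\<close> the vector of the numbers of attempted transmissions for the chain started at \<open>x\<close>.
  In the model below \<open>N x n $ i \<le> users E A N x n $ i\<close> holds almost surely, so the natural
  number subtraction truncates only on a null set.
\<close>

primrec users ::
    "('k \<times> 'k) set \<Rightarrow> (nat \<Rightarrow> 'w \<Rightarrow> nat ^ 'k) \<Rightarrow> (nat ^ 'k \<Rightarrow> nat \<Rightarrow> 'w \<Rightarrow> nat ^ 'k)
       \<Rightarrow> nat ^ 'k \<Rightarrow> nat \<Rightarrow> 'w \<Rightarrow> nat ^ ('k::finite)" where
  "users E A N x 0 \<omega> = x"
| "users E A N x (Suc n) \<omega> =
     (\<chi> i. users E A N x n \<omega> $ i + A (Suc n) \<omega> $ i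
           - of_bool (N x n \<omega> $ i = 1) * (\<Prod>j\<in>nbhd E i - {i}. of_bool (N x n \<omega> $ j = 0)))"

text \<open>
  Everything that happened up to time \<open>n\<close> before the transmission attempts of slot \<open>n\<close>;
  \<open>users E A N x m\<close> for \<open>m \<le> n\<close> is determined by it.
\<close>

definition history ::
    "(nat \<Rightarrow> 'w \<Rightarrow> nat ^ 'k) \<Rightarrow> (nat ^ 'k \<Rightarrow> nat \<Rightarrow> 'w \<Rightarrow> nat ^ 'k) \<Rightarrow> nat ^ 'k \<Rightarrow> nat
       \<Rightarrow> (nat \<Rightarrow> nat ^ 'k) \<Rightarrow> (nat \<Rightarrow> nat ^ ('k::finite)) \<Rightarrow> 'w \<Rightarrow> bool" where
  "history A N x n a \<nu> \<omega> \<longleftrightarrow> (\<forall>m\<le>n. A m \<omega> = a m) \<and> (\<forall>m<n. N x m \<omega> = \<nu> m)"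

text \<open>
  All variables are discrete, so the conditional laws are given by elementary conditional
  probabilities.  \<open>attempts_law\<close> includes the convention $N_i(n) = 0$ if $W_i(n) = 0$.  Together
  with \<open>arrivals_fresh\<close> it says that each \<open>users E A N x\<close> is a Markov chain with the prescribed
  transition law; nothing is assumed about the joint law of \<open>N x\<close> and \<open>N y\<close> for \<open>x \<noteq> y\<close>.
\<close>

locale random_access_model = prob_space M for M :: "'w measure" +
  fixes E :: "('k::finite \<times> 'k) set"
    and A :: "nat \<Rightarrow> 'w \<Rightarrow> nat ^ 'k"
    and N :: "nat ^ 'k \<Rightarrow> nat \<Rightarrow> 'w \<Rightarrow> nat ^ 'k"
    and rate :: "real ^ 'k"
  assumes undirected: "sym E"
    and connected_graph: "\<And>i j. (i, j) \<in> E\<^sup>*"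
    and arrivals_indep: "indep_vars (\<lambda>_. count_space UNIV) A UNIV"
    and arrivals_identical:
      "\<And>n. distr M (count_space UNIV) (A n) = distr M (count_space UNIV) (A 0)"
    and arrivals_mean: "\<And>n i. has_bochner_integral M (\<lambda>\<omega>. real (A n \<omega> $ i)) (rate $ i)"
    and rates_pos: "\<And>i. 0 < rate $ i"
    and attempts_measurable: "\<And>x n. N x n \<in> measurable M (count_space UNIV)"
    and attempts_law: "\<And>x n a \<nu> w k.
      \<P>(\<omega> in M. history A N x n a \<nu> \<omega> \<and> users E A N x n \<omega> = w) > 0 \<Longrightarrow>
      \<P>(\<omega> in M. N x n \<omega> = k \<bar> history A N x n a \<nu> \<omega> \<and> users E A N x n \<omega> = w) =
        (\<Prod>i\<in>UNIV. pmf (binomial_pmf (w $ i) (1 / real (\<Sum>j\<in>nbhd E i. w $ j))) (k $ i))"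
    and arrivals_fresh: "\<And>x n a \<nu> k b.
      \<P>(\<omega> in M. A (Suc n) \<omega> = b \<and> (history A N x n a \<nu> \<omega> \<and> N x n \<omega> = k)) =
        \<P>(\<omega> in M. A (Suc n) \<omega> = b) * \<P>(\<omega> in M. history A N x n a \<nu> \<omega> \<and> N x n \<omega> = k)"

section \<open>Fluid limits\<close>

definition total :: "nat ^ 'k \<Rightarrow> nat" where
  "total x = (\<Sum>k\<in>(UNIV :: 'k::finite set). x $ k)"

definition rescaled ::
    "('k \<times> 'k) set \<Rightarrow> (nat \<Rightarrow> 'w \<Rightarrow> nat ^ 'k) \<Rightarrow> (nat ^ 'k \<Rightarrow> nat \<Rightarrow> 'w \<Rightarrow> nat ^ 'k)
       \<Rightarrow> nat ^ 'k \<Rightarrow> 'w \<Rightarrow> real \<Rightarrow> real ^ ('k::finite)" where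
  "rescaled E A N x \<omega> t =
     (\<chi> i. real (users E A N x (nat \<lceil>real (total x) * t\<rceil>) \<omega> $ i) / real (total x))"

text \<open>
  A fluid limit is a random path that is almost surely an accumulation point of the random
  sequence of paths; the subsequence along which it is approached may depend on \<open>\<omega>\<close>, and no
  measurability of \<open>z\<close> is required.
\<close>

definition fluid_limit ::
    "'w measure \<Rightarrow> ('k \<times> 'k) set \<Rightarrow> (nat \<Rightarrow> 'w \<Rightarrow> nat ^ 'k)
       \<Rightarrow> (nat ^ 'k \<Rightarrow> nat \<Rightarrow> 'w \<Rightarrow> nat ^ 'k) \<Rightarrow> ('w \<Rightarrow> real \<Rightarrow> real ^ ('k::finite)) \<Rightarrow> bool" where
  "fluid_limit M E A N z \<longleftrightarrow>
     (\<exists>x :: nat \<Rightarrow> nat ^ 'k. filterlim (\<lambda>n. total (x n)) at_top sequentially \<and>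
        (AE \<omega> in M. cadlag (z \<omega>) \<and>
           accumulation_point skorokhod_topology (\<lambda>n. rescaled E A N (x n) \<omega>) (z \<omega>)))"

definition local_share :: "('k \<times> 'k) set \<Rightarrow> real ^ 'k \<Rightarrow> 'k::finite \<Rightarrow> real" where
  "local_share E v i = v $ i / (\<Sum>j\<in>nbhd E i. v $ j)"

end

theory Submission
  imports Defs "HOL-Real_Asymp.Real_Asymp"
begin

text \<open>
  The conditional probability that vertex $i$ succeeds, given $W(n) = w$, is a function $p_i(w)$, and
  $p_i(w) \to \varphi_i e^{-\sum_{j \in V_i} \varphi_j}$ when $w/|w|$ converges to a point where all
  neighbourhood sums are positive.  The departures compensated by $\sum p_i(W(m))$ form a
  martingale with bounded increments; its exponential tail bound is summable over all initial
  states, so by Borel--Cantelli the fluctuations are $o(|x|)$ simultaneously for all chains $W^x$.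
  The arrivals, common to all chains, obey the strong law of large numbers.  Hence every fluid
  limit is Lipschitz, Skorokhod convergence to it is locally uniform, and near $t$ the rescaled
  chain drifts at a rate arbitrarily close to $\lambda_i - p_i$.
\<close>

text \<open>Only a first moment of the arrivals is available, so no exponential tail bound holds for
  them, whereas departures are 0/1 and admit one. This dictates the split. The arrival sums do not
  depend on the initial state, so a single law of large numbers serves every chain; only the
  departures need a bound that survives a union. That union runs over all states of mass
  \<open>r\<close> and all times up to \<open>T * r\<close>, polynomially many pairs against a bound
  exponential in \<open>r\<close>, so tail bounds at fixed times suffice. All variables are
  discrete, so conditioning is done on the atoms of the past. After the drift estimate the argument
  is deterministic at a fixed sample point: it uses only that every basic neighbourhood of the limit
  is visited infinitely often, and combines this with facts that hold eventually. Shares have no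
  limit where a neighbourhood sum vanishes; therefore the drift is evaluated only on a short time
  window around \<open>t\<close>, on which the success probability is nearly constant.\<close>

section \<open>The strong law of large numbers\<close>

text \<open>This is the maximum of the partial sums \<open>\<Sum>k<m. f (\<omega> k)\<close> over
  \<open>0 \<le> m \<le> n\<close>. Splitting off the first step, instead of taking a
  \<open>Max\<close>, makes the comparison with the shifted sequence immediate.\<close>

primrec walk_max :: "('a \<Rightarrow> real) \<Rightarrow> nat \<Rightarrow> (nat \<Rightarrow> 'a) \<Rightarrow> real" where
  "walk_max f 0 \<omega> = 0"
| "walk_max f (Suc n) \<omega> = max 0 (f (\<omega> 0) + walk_max f n (\<lambda>k. \<omega> (Suc k)))"

lemma walk_max_nonneg: "0 \<le> walk_max f n \<omega>"
  by (cases n) auto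

lemma sum_le_walk_max: "(\<Sum>k<n. f (\<omega> k)) \<le> walk_max f n \<omega>"
proof (induction n arbitrary: \<omega>)
  case (Suc n)
  have "(\<Sum>k<Suc n. f (\<omega> k)) = f (\<omega> 0) + (\<Sum>k<n. f (\<omega> (Suc k)))"
    by (rule sum.lessThan_Suc_shift)
  with Suc[of "\<lambda>k. \<omega> (Suc k)"] show ?case by simp
qed simp

lemma walk_max_le_sum_abs: "walk_max f n \<omega> \<le> (\<Sum>k<n. \<bar>f (\<omega> k)\<bar>)"
proof (induction n arbitrary: \<omega>)
  case (Suc n)
  have "(\<Sum>k<Suc n. \<bar>f (\<omega> k)\<bar>) = \<bar>f (\<omega> 0)\<bar> + (\<Sum>k<n. \<bar>f (\<omega> (Suc k))\<bar>)"
    by (rule sum.lessThan_Suc_shift)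
  moreover have "0 \<le> (\<Sum>k<n. \<bar>f (\<omega> (Suc k))\<bar>)"
    by (rule sum_nonneg) simp
  ultimately show ?case
    using Suc[of "\<lambda>k. \<omega> (Suc k)"] by (simp del: sum.lessThan_Suc)
qed simp

lemma walk_max_mono: "m \<le> n \<Longrightarrow> walk_max f m \<omega> \<le> walk_max f n \<omega>"
proof -
  have "walk_max f n \<omega> \<le> walk_max f (Suc n) \<omega>" for n
  proof (induction n arbitrary: \<omega>)
    case (Suc n)
    show ?case
      using Suc[of "\<lambda>k. \<omega> (Suc k)"]
      by (simp only: walk_max.simps(2)[of f n] walk_max.simps(2)[of f "Suc n"])
  qed simp
  then show "m \<le> n \<Longrightarrow> ?thesis"
    using lift_Suc_mono_le[of "\<lambda>n. walk_max f n \<omega>"] by blast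
qed

text \<open>Prepending a step moves all nonempty partial sums by the fixed amount
  \<open>f s\<close>, so being unbounded above is a shift-invariant event.\<close>

lemma walk_max_case_nat_unbounded_iff:
  "(\<forall>c. \<exists>n. c < walk_max f n (case_nat s \<omega>)) \<longleftrightarrow> (\<forall>c. \<exists>n. c < walk_max f n \<omega>)"
proof safe
  fix c assume *: "\<forall>c. \<exists>n. c < walk_max f n (case_nat s \<omega>)"
  obtain n where n: "max 0 (c + f s) < walk_max f n (case_nat s \<omega>)"
    using * by blast
  then obtain m where "n = Suc m" by (cases n) auto
  with n show "\<exists>n. c < walk_max f n \<omega>"
    by (intro exI[of _ m]) (auto simp: max_def split: if_splits)
next
  fix c assume *: "\<forall>c. \<exists>n. c < walk_max f n \<omega>"
  then obtain n where "c - f s < walk_max f n \<omega>" by blast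
  then show "\<exists>n. c < walk_max f n (case_nat s \<omega>)"
    by (intro exI[of _ "Suc n"]) auto
qed

context sequence_space
begin

lemma walk_max_measurable [measurable]:
  assumes [measurable]: "f \<in> borel_measurable M"
  shows "walk_max f n \<in> borel_measurable S"
proof (induction n)
  case (Suc n)
  note [measurable] = Suc
  have [measurable]: "(\<lambda>\<omega> k. \<omega> (Suc k)) \<in> measurable S S"
    by (rule measurable_PiM_single') (auto simp: space_PiM PiE_iff)
  have "(\<lambda>\<omega>. walk_max f n (\<lambda>k. \<omega> (Suc k))) \<in> borel_measurable S"
    using measurable_compose[OF \<open>(\<lambda>\<omega> k. \<omega> (Suc k)) \<in> measurable S S\<close> Suc] by simp
  then show ?case by simp
qed simp

lemma integrable_component:
  assumes "integrable M (f :: 'a \<Rightarrow> real)"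
  shows "integrable S (\<lambda>\<omega>. f (\<omega> i))" "(\<integral>\<omega>. f (\<omega> i) \<partial>S) = integral\<^sup>L M f"
proof -
  have d: "distr S M (\<lambda>\<omega>. \<omega> i) = M"
    by (rule PiM_component) auto
  have [measurable]: "f \<in> borel_measurable M" using assms by auto
  show "integrable S (\<lambda>\<omega>. f (\<omega> i))"
    using assms by (subst integrable_distr_eq[of "\<lambda>\<omega>. \<omega> i" S M f, symmetric]) (auto simp: d)
  show "(\<integral>\<omega>. f (\<omega> i) \<partial>S) = integral\<^sup>L M f"
    by (subst integral_distr[of "\<lambda>\<omega>. \<omega> i" S M f, symmetric]) (auto simp: d)
qed

lemma integrable_walk_max:
  assumes f: "integrable M f"
  shows "integrable S (walk_max f n)"
proof -
  have [measurable]: "f \<in> borel_measurable M" using f by auto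
  have "integrable S (\<lambda>\<omega>. \<Sum>k<n. \<bar>f (\<omega> k)\<bar>)"
    using f by (intro Bochner_Integration.integrable_sum integrable_abs integrable_component)
  then show ?thesis
    by (rule Bochner_Integration.integrable_bound)
       (auto simp: walk_max_nonneg intro!: AE_I2 order_trans[OF walk_max_le_sum_abs])
qed

text \<open>
  On the shift-invariant event that the walk is unbounded above, comparing the walk with its shift
  by one step shows that the mean of a single step cannot be negative.
\<close>

lemma AE_bounded_above_of_negative_mean:
  fixes f :: "'a \<Rightarrow> real"
  assumes f: "integrable M f" and neg: "integral\<^sup>L M f < 0"
  shows "AE \<omega> in S. \<exists>c. \<forall>n. (\<Sum>k<n. f (\<omega> k)) \<le> c"
proof -
  have [measurable]: "f \<in> borel_measurable M" using f by auto
  \<comment> \<open>Thresholds in the naturals keep the event a countable combination, hence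
    measurable; \<open>B_iff\<close> restores real thresholds.\<close>
  define B where "B = {\<omega> \<in> space S. \<forall>c::nat. \<exists>n. real c < walk_max f n \<omega>}"
  have [measurable]: "B \<in> sets S" unfolding B_def by measurable
  have B_iff: "\<omega> \<in> B \<longleftrightarrow> \<omega> \<in> space S \<and> (\<forall>c. \<exists>n. c < walk_max f n \<omega>)" for \<omega>
  proof -
    have "\<exists>n. c < walk_max f n \<omega>" if "\<forall>c::nat. \<exists>n. real c < walk_max f n \<omega>" for c
    proof -
      obtain k where "c < real k" using reals_Archimedean2 by blast
      with that show ?thesis using order.strict_trans by blast
    qed
    then show ?thesis unfolding B_def by blast
  qed
  define I where "I = (\<lambda>n. \<integral>\<omega>. walk_max f n \<omega> * indicator B \<omega> \<partial>S)"
  let ?P = "M \<Otimes>\<^sub>M S"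
  interpret MS: pair_prob_space M S ..
  have comb[measurable]: "(\<lambda>(s, \<omega>). case_nat s \<omega>) \<in> measurable ?P S"
    by measurable
  have int: "integrable S (\<lambda>\<omega>. walk_max f n \<omega> * indicator B \<omega>)" for n
    using integrable_walk_max[OF f, of n] by (intro integrable_real_mult_indicator) auto
  have sn: "distr ?P S snd = S"
  proof (rule measure_eqI)
    fix A assume "A \<in> sets (distr ?P S snd)"
    then have A: "A \<in> sets S" by simp
    then have "snd -` A \<inter> space ?P = space M \<times> A"
      using sets.sets_into_space by (auto simp: space_pair_measure)
    with A show "emeasure (distr ?P S snd) A = emeasure S A"
      by (simp add: emeasure_distr P.emeasure_pair_measure_Times M.emeasure_space_1)
  qed simp
  have fs: "distr ?P M fst = M"
    by (rule P.distr_pair_fst)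
  \<comment> \<open>Prepending an independent step preserves the product measure
    (\<open>PiM_iter\<close>) and adds \<open>max (- walk_max f n \<omega>) (f s)\<close> to the
    maximum. On \<open>B\<close> the mean of this increment is \<open>I (Suc n) - I n\<close>,
    nonnegative because \<open>walk_max\<close> grows with \<open>n\<close>.\<close>
  have step: "0 \<le> (\<integral>p. max (- walk_max f n (snd p)) (f (fst p)) * indicator B (snd p) \<partial>?P)" for n
  proof -
    have a: "integrable ?P (\<lambda>p. walk_max f n (snd p) * indicator B (snd p))"
      using int[of n] integrable_distr_eq[of snd ?P S "\<lambda>\<omega>. walk_max f n \<omega> * indicator B \<omega>"]
      by (simp add: sn)
    have b: "I n = (\<integral>p. walk_max f n (snd p) * indicator B (snd p) \<partial>?P)"
      unfolding I_def
      using integral_distr[of snd ?P S "\<lambda>\<omega>. walk_max f n \<omega> * indicator B \<omega>"]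
      by (simp add: sn)
    have eq: "walk_max f (Suc n) ((\<lambda>(s, \<omega>). case_nat s \<omega>) p) * indicator B ((\<lambda>(s, \<omega>). case_nat s \<omega>) p)
        = walk_max f n (snd p) * indicator B (snd p)
          + max (- walk_max f n (snd p)) (f (fst p)) * indicator B (snd p)"
      if "p \<in> space ?P" for p
    proof -
      obtain s \<omega> where p: "p = (s, \<omega>)" by (cases p)
      have "s \<in> space M" "\<omega> \<in> space S" using that p by (auto simp: space_pair_measure)
      then have "case_nat s \<omega> \<in> space S"
        by (auto simp: space_PiM PiE_iff split: nat.split)
      then have "case_nat s \<omega> \<in> B \<longleftrightarrow> \<omega> \<in> B"
        using \<open>\<omega> \<in> space S\<close> by (simp add: B_iff walk_max_case_nat_unbounded_iff)
      then show ?thesis by (auto simp: p indicator_def max_def)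
    qed
    have c0: "integrable ?P (\<lambda>p. walk_max f (Suc n) ((\<lambda>(s, \<omega>). case_nat s \<omega>) p)
          * indicator B ((\<lambda>(s, \<omega>). case_nat s \<omega>) p))"
      using int[of "Suc n"]
        integrable_distr_eq[OF comb, of "\<lambda>\<omega>. walk_max f (Suc n) \<omega> * indicator B \<omega>"]
      by (simp add: PiM_iter del: walk_max.simps)
    have c: "integrable ?P (\<lambda>p. walk_max f n (snd p) * indicator B (snd p)
          + max (- walk_max f n (snd p)) (f (fst p)) * indicator B (snd p))"
      using c0 by (rule Bochner_Integration.integrable_cong[THEN iffD1, rotated -1])
        (simp_all only: eq)
    have "I (Suc n) = (\<integral>p. walk_max f (Suc n) ((\<lambda>(s, \<omega>). case_nat s \<omega>) p)
          * indicator B ((\<lambda>(s, \<omega>). case_nat s \<omega>) p) \<partial>?P)"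
      unfolding I_def
      using integral_distr[OF comb, of "\<lambda>\<omega>. walk_max f (Suc n) \<omega> * indicator B \<omega>"]
      by (simp add: PiM_iter del: walk_max.simps)
    also have "\<dots> = (\<integral>p. walk_max f n (snd p) * indicator B (snd p)
          + max (- walk_max f n (snd p)) (f (fst p)) * indicator B (snd p) \<partial>?P)"
      by (rule Bochner_Integration.integral_cong) (simp_all only: eq)
    finally have "I (Suc n) - I n = (\<integral>p. (walk_max f n (snd p) * indicator B (snd p)
          + max (- walk_max f n (snd p)) (f (fst p)) * indicator B (snd p))
          - walk_max f n (snd p) * indicator B (snd p) \<partial>?P)"
      unfolding b using a c by (simp only: Bochner_Integration.integral_diff)
    moreover have "I n \<le> I (Suc n)"
      unfolding I_def using int walk_max_mono[of n "Suc n" f]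
      by (intro integral_mono) (auto simp: indicator_def simp del: walk_max.simps)
    ultimately show ?thesis by simp
  qed
  \<comment> \<open>On \<open>B\<close> the maxima tend to infinity, so the truncation of
    \<open>f\<close> from below eventually disappears. Nonnegativity of \<open>walk_max\<close>
    makes \<open>\<bar>f\<bar>\<close> a dominating function.\<close>
  have "(\<lambda>n. \<integral>p. max (- walk_max f n (snd p)) (f (fst p)) * indicator B (snd p) \<partial>?P)
      \<longlonglongrightarrow> (\<integral>p. f (fst p) * indicator B (snd p) \<partial>?P)"
  proof (rule integral_dominated_convergence[where w = "\<lambda>p. \<bar>f (fst p)\<bar>"])
    show "integrable ?P (\<lambda>p. \<bar>f (fst p)\<bar>)"
      using f integrable_distr_eq[of fst ?P M f] by (simp add: fs)
    show "AE p in ?P. (\<lambda>n. max (- walk_max f n (snd p)) (f (fst p)) * indicator B (snd p))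
        \<longlonglongrightarrow> f (fst p) * indicator B (snd p)"
    proof (intro AE_I2)
      fix p
      show "(\<lambda>n. max (- walk_max f n (snd p)) (f (fst p)) * indicator B (snd p))
        \<longlonglongrightarrow> f (fst p) * indicator B (snd p)"
      proof (cases "snd p \<in> B")
        case True
        then obtain m where m: "- f (fst p) < walk_max f m (snd p)" using B_iff by blast
        have "\<forall>\<^sub>F n in sequentially. max (- walk_max f n (snd p)) (f (fst p)) * indicator B (snd p)
            = f (fst p) * indicator B (snd p)"
          using eventually_ge_at_top[of m]
        proof eventually_elim
          case (elim n)
          show ?case using walk_max_mono[OF elim, of f "snd p"] m by (simp add: max_def)
        qed
        then show ?thesis by (rule tendsto_eventually)
      qed simp
    qed
    show "AE p in ?P. norm (max (- walk_max f n (snd p)) (f (fst p)) * indicator B (snd p))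
        \<le> \<bar>f (fst p)\<bar>" for n
    proof (intro AE_I2)
      fix p
      show "norm (max (- walk_max f n (snd p)) (f (fst p)) * indicator B (snd p)) \<le> \<bar>f (fst p)\<bar>"
        using walk_max_nonneg[of f n "snd p"] by (auto simp: indicator_def max_def)
    qed
  qed measurable
  then have "0 \<le> (\<integral>p. f (fst p) * indicator B (snd p) \<partial>?P)"
    by (rule LIMSEQ_le_const) (use step in auto)
  \<comment> \<open>The new step is independent of \<open>B\<close>, so the limit factors into the
    mean of \<open>f\<close> times the measure of \<open>B\<close>.\<close>
  also have "\<dots> = (\<integral>\<omega>. (\<integral>s. f s * indicator B \<omega> \<partial>M) \<partial>S)"
  proof -
    have "integrable ?P (\<lambda>p. f (fst p))"
      using f integrable_distr_eq[of fst ?P M f] by (simp add: fs)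
    then have "integrable ?P (\<lambda>(s, \<omega>). f s * indicator B \<omega>)"
      by (rule Bochner_Integration.integrable_bound) (auto simp: indicator_def split_beta')
    then show ?thesis
      using MS.integral_snd[of "\<lambda>s \<omega>. f s * indicator B \<omega>"] by (simp add: split_beta')
  qed
  also have "\<dots> = integral\<^sup>L M f * measure S B"
    using f by simp
  finally have "measure S B = 0"
    using neg by (simp add: zero_le_mult_iff measure_le_0_iff)
  then have "AE \<omega> in S. \<omega> \<notin> B"
    by (subst (asm) P.prob_eq_0) auto
  moreover have "AE \<omega> in S. \<omega> \<in> space S" by simp
  ultimately show ?thesis
  proof eventually_elim
    case (elim \<omega>)
    then obtain c where "\<forall>n. walk_max f n \<omega> \<le> c" by (auto simp: B_iff not_less)
    then have "\<forall>n. (\<Sum>k<n. f (\<omega> k)) \<le> c"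
      using order_trans[OF sum_le_walk_max] by blast
    then show ?case ..
  qed
qed

text \<open>With \<open>d\<close> strictly between the mean and \<open>c\<close>, the preceding
  lemma applied to \<open>f - d\<close> bounds the sums by \<open>b + n * d\<close>, and
  \<open>n * (c - d)\<close> eventually exceeds the constant \<open>b\<close>.\<close>

lemma AE_average_eventually_less:
  assumes f: "integrable M f" and c: "integral\<^sup>L M f < c"
  shows "AE \<omega> in S. \<forall>\<^sub>F n in sequentially. (\<Sum>k<n. f (\<omega> k)) / real n < c"
proof -
  define d where "d = (integral\<^sup>L M f + c) / 2"
  have d: "integral\<^sup>L M f < d" "d < c" using c by (auto simp: d_def)
  have "AE \<omega> in S. \<exists>b. \<forall>n. (\<Sum>k<n. f (\<omega> k) - d) \<le> b"
    using f d by (intro AE_bounded_above_of_negative_mean) (auto simp: M.prob_space)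
  then show ?thesis
  proof eventually_elim
    case (elim \<omega>)
    then obtain b where b: "\<And>n. (\<Sum>k<n. f (\<omega> k)) \<le> b + real n * d"
      by (auto simp: sum_subtractf algebra_simps)
    obtain m :: nat where m: "b / (c - d) < real m" using reals_Archimedean2 by blast
    show ?case
      using eventually_gt_at_top[of "max 0 m"]
    proof eventually_elim
      case (elim n)
      then have "b / (c - d) < real n" using m by simp
      then have "b < real n * (c - d)" using d by (simp add: divide_less_eq mult.commute)
      with b[of n] have "(\<Sum>k<n. f (\<omega> k)) < real n * c" by (simp add: algebra_simps)
      with elim show ?case by (simp add: divide_less_eq mult.commute)
    qed
  qed
qed

lemma strong_law:
  assumes f: "integrable M f"
  shows "AE \<omega> in S. (\<lambda>n. (\<Sum>k<n. f (\<omega> k)) / real n) \<longlonglongrightarrow> integral\<^sup>L M f"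
proof -
  let ?\<mu> = "integral\<^sup>L M f"
  have "AE \<omega> in S. \<forall>j::nat. \<forall>\<^sub>F n in sequentially. (\<Sum>k<n. f (\<omega> k)) / real n < ?\<mu> + 1 / Suc j"
    using f by (intro AE_all_countable[THEN iffD2] allI AE_average_eventually_less) auto
  moreover have "AE \<omega> in S. \<forall>j::nat. \<forall>\<^sub>F n in sequentially.
      (\<Sum>k<n. - f (\<omega> k)) / real n < - ?\<mu> + 1 / Suc j"
    using f by (intro AE_all_countable[THEN iffD2] allI AE_average_eventually_less) auto
  ultimately show ?thesis
  proof eventually_elim
    case (elim \<omega>)
    show ?case
    proof (rule LIMSEQ_I)
      fix r :: real assume "0 < r"
      then obtain j where j: "1 / Suc j < r" using nat_approx_posE by blast
      have "\<forall>\<^sub>F n in sequentially. norm ((\<Sum>k<n. f (\<omega> k)) / real n - ?\<mu>) < r"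
        using elim(1)[rule_format, of j] elim(2)[rule_format, of j]
        by eventually_elim (use j in \<open>auto simp: sum_negf abs_less_iff\<close>)
      then show "\<exists>no. \<forall>n\<ge>no. norm ((\<Sum>k<n. f (\<omega> k)) / real n - ?\<mu>) < r"
        by (simp add: eventually_sequentially)
    qed
  qed
qed

end

text \<open>The joint law of an i.i.d. sequence is the product measure, so the result transfers from
  the canonical sequence space.\<close>

lemma (in prob_space) strong_law_of_large_numbers:
  fixes X :: "nat \<Rightarrow> 'a \<Rightarrow> 'b" and f :: "'b \<Rightarrow> real"
  assumes indep: "indep_vars (\<lambda>_. L) X UNIV"
    and ident: "\<And>n. distr M L (X n) = distr M L (X 0)"
    and f [measurable]: "f \<in> borel_measurable L" and int: "integrable M (\<lambda>\<omega>. f (X 0 \<omega>))"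
  shows "AE \<omega> in M. (\<lambda>n. (\<Sum>k<n. f (X k \<omega>)) / real n) \<longlonglongrightarrow> expectation (\<lambda>\<omega>. f (X 0 \<omega>))"
proof -
  have [measurable]: "random_variable L (X i)" for i
    using indep by (auto simp: indep_vars_def)
  define D where "D = distr M L (X 0)"
  interpret D: prob_space D unfolding D_def by (rule prob_space_distr) simp
  interpret DS: sequence_space D by unfold_locales
  have sets_D: "sets D = sets L" by (simp add: D_def)
  have "distr M (\<Pi>\<^sub>M i\<in>UNIV. L) (\<lambda>\<omega>. \<lambda>i\<in>UNIV. X i \<omega>) = (\<Pi>\<^sub>M i\<in>UNIV. distr M L (X i))"
    using indep by (subst indep_vars_iff_distr_eq_PiM[symmetric]) auto
  also have "\<dots> = DS.S" unfolding D_def by (intro PiM_cong refl ident)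
  finally have dist: "distr M (\<Pi>\<^sub>M i\<in>UNIV. L) (\<lambda>\<omega> i. X i \<omega>) = DS.S"
    by (simp add: restrict_UNIV)
  have fD: "integrable D f" "integral\<^sup>L D f = expectation (\<lambda>\<omega>. f (X 0 \<omega>))"
    unfolding D_def using int by (auto simp: integrable_distr_eq integral_distr)
  have meas [measurable]: "(\<lambda>\<omega> i. X i \<omega>) \<in> measurable M (\<Pi>\<^sub>M i\<in>UNIV. L)"
    by (rule measurable_PiM_single')
       (auto simp: space_PiM PiE_iff intro: measurable_space[of _ M L])
  have "AE \<omega> in distr M (\<Pi>\<^sub>M i\<in>UNIV. L) (\<lambda>\<omega> i. X i \<omega>).
      (\<lambda>n. (\<Sum>k<n. f (\<omega> k)) / real n) \<longlonglongrightarrow> integral\<^sup>L D f"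
    unfolding dist using fD(1) by (rule DS.strong_law)
  then show ?thesis
    by (subst (asm) AE_distr_iff) (auto simp: fD(2))
qed

section \<open>The law of a transmission slot\<close>

text \<open>If a neighbourhood holds no users, the parameter is \<open>1 / 0 = 0\<close> and
  \<open>w $ i = 0\<close> as well, so the vertex stays silent.\<close>

definition attempt_pmf :: "('k \<times> 'k) set \<Rightarrow> nat ^ 'k \<Rightarrow> (nat ^ 'k::finite) pmf" where
  "attempt_pmf E w = map_pmf vec_lambda
     (Pi_pmf UNIV 0 (\<lambda>i. binomial_pmf (w $ i) (1 / real (\<Sum>j\<in>nbhd E i. w $ j))))"

definition success :: "('k \<times> 'k) set \<Rightarrow> 'k \<Rightarrow> nat ^ 'k::finite \<Rightarrow> bool" where
  "success E i k \<longleftrightarrow> k $ i = 1 \<and> (\<forall>j\<in>nbhd E i - {i}. k $ j = 0)"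

definition success_prob :: "('k \<times> 'k) set \<Rightarrow> 'k \<Rightarrow> nat ^ 'k::finite \<Rightarrow> real" where
  "success_prob E i w = measure_pmf.prob (attempt_pmf E w) {k. success E i k}"

lemma success_prob_bounds: "0 \<le> success_prob E i w" "success_prob E i w \<le> 1"
  by (auto simp: success_prob_def)

lemma of_bool_success:
  "of_bool (k $ i = 1) * (\<Prod>j\<in>nbhd E i - {i}. of_bool (k $ j = 0)) = (of_bool (success E i k) :: nat)"
  by (auto simp: success_def)

lemma vec_lambda_bij: "bij vec_lambda"
  by (rule o_bij[of vec_nth]) (auto simp: fun_eq_iff vec_eq_iff)

text \<open>The bridge to the model: the right-hand side is the product that occurs in
  \<open>attempts_law\<close>.\<close>

lemma pmf_attempt:
  "pmf (attempt_pmf E w) k =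
     (\<Prod>i\<in>UNIV. pmf (binomial_pmf (w $ i) (1 / real (\<Sum>j\<in>nbhd E i. w $ j))) (k $ i))"
proof -
  have "k = vec_lambda (vec_nth k)" by simp
  then have "pmf (attempt_pmf E w) k = pmf (attempt_pmf E w) (vec_lambda (vec_nth k))" by simp
  also have "\<dots> = pmf (Pi_pmf UNIV 0 (\<lambda>i. binomial_pmf (w $ i) (1 / real (\<Sum>j\<in>nbhd E i. w $ j)))) (vec_nth k)"
    unfolding attempt_pmf_def by (rule pmf_map_inj') (rule bij_is_inj[OF vec_lambda_bij])
  also have "\<dots> = (\<Prod>i\<in>UNIV. pmf (binomial_pmf (w $ i) (1 / real (\<Sum>j\<in>nbhd E i. w $ j))) (k $ i))"
    by (rule pmf_Pi') auto
  finally show ?thesis .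
qed

lemma attempt_prob_in_0_1:
  fixes w :: "nat ^ 'k::finite"
  shows "1 / real (\<Sum>j\<in>nbhd E i. w $ j) \<in> {0..1}"
  by (cases "(\<Sum>j\<in>nbhd E i. w $ j) = 0") (auto simp: divide_le_eq simp del: sum_eq_0_iff of_nat_sum)

text \<open>Success restricts only the coordinates in \<open>nbhd E i\<close>, so by independence it
  is a product with trivial factors elsewhere. Each neighbour \<open>j\<close> contributes with the
  sum over its own neighbourhood. At \<open>w $ i = 0\<close> the truncated exponent
  \<open>w $ i - 1\<close> does no harm, since the first factor vanishes.\<close>

lemma success_prob_eq:
  "success_prob E i w =
     real (w $ i) * (1 / real (\<Sum>j\<in>nbhd E i. w $ j)) * (1 - 1 / real (\<Sum>j\<in>nbhd E i. w $ j)) ^ (w $ i - 1)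
     * (\<Prod>j\<in>nbhd E i - {i}. (1 - 1 / real (\<Sum>l\<in>nbhd E j. w $ l)) ^ (w $ j))"
proof -
  define q where "q = (\<lambda>i. binomial_pmf (w $ i) (1 / real (\<Sum>j\<in>nbhd E i. w $ j)))"
  define B where "B = (\<lambda>j. if j = i then {1} else if j \<in> nbhd E i then {0} else UNIV :: nat set)"
  have "vec_lambda -` {k. success E i k} = Pi UNIV B"
    by (auto simp: success_def B_def Pi_iff split: if_splits) (auto simp: nbhd_def)
  then have "success_prob E i w = measure_pmf.prob (Pi_pmf UNIV 0 q) (Pi UNIV B)"
    by (simp add: success_prob_def attempt_pmf_def q_def)
  also have "\<dots> = (\<Prod>j\<in>UNIV. measure_pmf.prob (q j) (B j))"
    by (rule measure_Pi_pmf_Pi) simp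
  also have "\<dots> = measure_pmf.prob (q i) (B i) * (\<Prod>j\<in>UNIV - {i}. measure_pmf.prob (q j) (B j))"
    by (rule prod.remove) auto
  also have "(\<Prod>j\<in>UNIV - {i}. measure_pmf.prob (q j) (B j)) =
      (\<Prod>j\<in>nbhd E i - {i}. measure_pmf.prob (q j) (B j))"
    by (rule prod.mono_neutral_right) (auto simp: B_def)
  also have "\<dots> = (\<Prod>j\<in>nbhd E i - {i}. (1 - 1 / real (\<Sum>l\<in>nbhd E j. w $ l)) ^ (w $ j))"
  proof (rule prod.cong)
    fix j assume "j \<in> nbhd E i - {i}"
    then show "measure_pmf.prob (q j) (B j) = (1 - 1 / real (\<Sum>l\<in>nbhd E j. w $ l)) ^ (w $ j)"
      using attempt_prob_in_0_1[of w E j]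
      by (simp add: B_def q_def measure_pmf_single)
  qed simp
  also have "measure_pmf.prob (q i) (B i) = real (w $ i) * (1 / real (\<Sum>j\<in>nbhd E i. w $ j))
      * (1 - 1 / real (\<Sum>j\<in>nbhd E i. w $ j)) ^ (w $ i - 1)"
    using attempt_prob_in_0_1[of w E i] by (simp add: B_def q_def measure_pmf_single)
  finally show ?thesis .
qed

section \<open>Asymptotics of the success probabilities\<close>

text \<open>The power is \<open>exp ((w / s) * (s * ln (1 - 1 / s)))\<close>, and
  \<open>s * ln (1 - 1 / s)\<close> tends to -1.\<close>

lemma tendsto_one_minus_inverse_power:
  fixes s :: "nat \<Rightarrow> real" and w :: "nat \<Rightarrow> nat"
  assumes s: "filterlim s at_top sequentially" and w: "(\<lambda>m. real (w m) / s m) \<longlonglongrightarrow> \<phi>"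
  shows "(\<lambda>m. (1 - 1 / s m) ^ w m) \<longlonglongrightarrow> exp (- \<phi>)"
proof -
  have "((\<lambda>x::real. x * ln (1 - 1 / x)) \<longlongrightarrow> -1) at_top" by real_asymp
  from filterlim_compose[OF this s]
  have "(\<lambda>m. exp (real (w m) / s m * (s m * ln (1 - 1 / s m)))) \<longlonglongrightarrow> exp (\<phi> * -1)"
    by (intro tendsto_exp tendsto_mult w)
  moreover have "\<forall>\<^sub>F m in sequentially. 1 < s m"
    using s by (simp add: filterlim_at_top_dense)
  then have "\<forall>\<^sub>F m in sequentially. exp (real (w m) / s m * (s m * ln (1 - 1 / s m))) = (1 - 1 / s m) ^ w m"
  proof eventually_elim
    case (elim m)
    then have "exp (real (w m) / s m * (s m * ln (1 - 1 / s m))) = exp (real (w m) * ln (1 - 1 / s m))"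
      by simp
    also have "\<dots> = (1 - 1 / s m) ^ w m" using elim by (simp add: exp_of_nat_mult)
    finally show ?case .
  qed
  ultimately show ?thesis by (auto elim: Lim_transform_eventually)
qed

text \<open>Positive limiting neighbourhood sums force every actual sum \<open>s j\<close> to
  infinity and let the shares converge, so each factor of \<open>success_prob_eq\<close> has an
  exponential limit.\<close>

lemma success_prob_tendsto:
  fixes W :: "nat \<Rightarrow> nat ^ 'k::finite" and r :: "nat \<Rightarrow> nat" and v :: "real ^ 'k"
  assumes r: "filterlim r at_top sequentially"
    and W: "\<And>j. (\<lambda>m. real (W m $ j) / real (r m)) \<longlonglongrightarrow> v $ j"
    and pos: "\<And>i. 0 < (\<Sum>j\<in>nbhd E i. v $ j)"
  shows "(\<lambda>m. success_prob E i (W m)) \<longlonglongrightarrow> local_share E v i * exp (- (\<Sum>j\<in>nbhd E i. local_share E v j))"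
proof -
  define s where "s = (\<lambda>j m. real (\<Sum>l\<in>nbhd E j. W m $ l))"
  have r': "filterlim (\<lambda>m. real (r m)) at_top sequentially"
    using r by (rule filterlim_compose[OF filterlim_real_sequentially])
  have rpos: "\<forall>\<^sub>F m in sequentially. 0 < real (r m)"
    using r' unfolding filterlim_at_top_dense by blast
  have sr: "(\<lambda>m. s j m / real (r m)) \<longlonglongrightarrow> (\<Sum>l\<in>nbhd E j. v $ l)" for j
    unfolding s_def of_nat_sum sum_divide_distrib by (intro tendsto_sum W)
  have s_top: "filterlim (s j) at_top sequentially" for j
  proof -
    have "filterlim (\<lambda>m. s j m / real (r m) * real (r m)) at_top sequentially"
      by (rule filterlim_tendsto_pos_mult_at_top[OF sr pos r'])
    moreover have "\<forall>\<^sub>F m in sequentially. s j m / real (r m) * real (r m) = s j m"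
      using rpos by eventually_elim simp
    ultimately show ?thesis by (simp cong: filterlim_cong)
  qed
  have share: "(\<lambda>m. real (W m $ j) / s j m) \<longlonglongrightarrow> local_share E v j" for j
  proof -
    have "(\<lambda>m. (real (W m $ j) / real (r m)) / (s j m / real (r m))) \<longlonglongrightarrow> v $ j / (\<Sum>l\<in>nbhd E j. v $ l)"
      using pos[of j] by (intro tendsto_divide W sr) auto
    moreover have "\<forall>\<^sub>F m in sequentially. (real (W m $ j) / real (r m)) / (s j m / real (r m)) = real (W m $ j) / s j m"
      using rpos by eventually_elim simp
    ultimately show ?thesis unfolding local_share_def by (rule Lim_transform_eventually)
  qed
  \<comment> \<open>The exponent in the factor of vertex \<open>i\<close> leaves out the
    transmitting user; this changes the ratio by at most \<open>1 / s i m\<close>.\<close>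
  have share': "(\<lambda>m. real (W m $ i - 1) / s i m) \<longlonglongrightarrow> local_share E v i"
  proof -
    have "(\<lambda>m. 1 / s i m) \<longlonglongrightarrow> 0"
      by (rule tendsto_divide_0[OF tendsto_const filterlim_at_top_imp_at_infinity[OF s_top]])
    then have "(\<lambda>m. (real (W m $ i) - real (W m $ i - 1)) / s i m) \<longlonglongrightarrow> 0"
      by (rule Lim_null_comparison[rotated]) (auto simp: s_def divide_right_mono sum_nonneg intro!: always_eventually)
    from tendsto_diff[OF share[of i] this] show ?thesis by (simp add: diff_divide_distrib)
  qed
  have "(\<lambda>m. real (W m $ i) / s i m * (1 - 1 / s i m) ^ (W m $ i - 1)
      * (\<Prod>j\<in>nbhd E i - {i}. (1 - 1 / s j m) ^ (W m $ j)))
    \<longlonglongrightarrow> local_share E v i * exp (- local_share E v i) * (\<Prod>j\<in>nbhd E i - {i}. exp (- local_share E v j))"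
    by (intro tendsto_mult tendsto_prod tendsto_one_minus_inverse_power share share' s_top)
  also have "local_share E v i * exp (- local_share E v i) * (\<Prod>j\<in>nbhd E i - {i}. exp (- local_share E v j))
      = local_share E v i * exp (- (\<Sum>j\<in>nbhd E i. local_share E v j))"
    by (simp add: nbhd_def sum.insert_remove exp_sum[symmetric] exp_add[symmetric] sum_negf mult.assoc)
  finally show ?thesis by (simp add: success_prob_eq s_def)
qed

text \<open>Many slots are summed later, which requires a bound uniform over states. If it failed
  for every radius \<open>1 / Suc m\<close> and threshold \<open>m\<close>, the counterexamples
  would form a sequence contradicting \<open>success_prob_tendsto\<close>.\<close>

lemma success_prob_near:
  fixes v :: "real ^ 'k::finite"
  assumes pos: "\<And>i. 0 < (\<Sum>j\<in>nbhd E i. v $ j)" and \<eta>: "0 < \<eta>"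
  shows "\<exists>\<rho>>0. \<exists>r0. \<forall>n\<ge>r0. \<forall>w. (\<forall>j. \<bar>real (w $ j) / real n - v $ j\<bar> \<le> \<rho>) \<longrightarrow>
    \<bar>success_prob E i w - local_share E v i * exp (- (\<Sum>j\<in>nbhd E i. local_share E v j))\<bar> \<le> \<eta>"
proof (rule ccontr)
  let ?P = "local_share E v i * exp (- (\<Sum>j\<in>nbhd E i. local_share E v j))"
  assume "\<not> ?thesis"
  then have "\<exists>n w. m \<le> n \<and> (\<forall>j. \<bar>real (w $ j) / real n - v $ j\<bar> \<le> 1 / real (Suc m))
      \<and> \<eta> < \<bar>success_prob E i w - ?P\<bar>" for m
    by (metis not_le of_nat_0_less_iff zero_less_Suc zero_less_divide_1_iff)
  then obtain r W where rW: "\<And>m. m \<le> r m"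
      "\<And>m j. \<bar>real (W m $ j) / real (r m) - v $ j\<bar> \<le> 1 / real (Suc m)"
      "\<And>m. \<eta> < \<bar>success_prob E i (W m) - ?P\<bar>"
    by metis
  have r: "filterlim r at_top sequentially"
    by (rule filterlim_at_top_mono[OF filterlim_ident]) (simp add: rW)
  have "(\<lambda>m. real (W m $ j) / real (r m)) \<longlonglongrightarrow> v $ j" for j
  proof -
    have "(\<lambda>m. real (W m $ j) / real (r m) - v $ j) \<longlonglongrightarrow> 0"
      by (rule Lim_null_comparison[OF _ LIMSEQ_inverse_real_of_nat])
         (use rW(2)[of _ j] in \<open>auto simp: inverse_eq_divide intro!: always_eventually\<close>)
    then show ?thesis by (simp add: LIM_zero_iff)
  qed
  from success_prob_tendsto[OF r this pos, of i]
  have "(\<lambda>m. \<bar>success_prob E i (W m) - ?P\<bar>) \<longlonglongrightarrow> \<bar>?P - ?P\<bar>"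
    by (intro tendsto_intros)
  then have "\<forall>\<^sub>F m in sequentially. \<bar>success_prob E i (W m) - ?P\<bar> < \<eta>"
    using \<eta> by (intro order_tendstoD) auto
  then obtain m where "\<bar>success_prob E i (W m) - ?P\<bar> < \<eta>"
    by (auto simp: eventually_sequentially)
  with rW(3)[of m] show False by linarith
qed

section \<open>Concentration of the departure process\<close>

lemma exp_le_quadratic:
  fixes \<theta> :: real
  assumes "\<bar>\<theta>\<bar> \<le> 1"
  shows "exp \<theta> \<le> 1 + \<theta> + \<theta>\<^sup>2"
proof (cases "0 \<le> \<theta>")
  case True
  then show ?thesis using assms exp_bound[of \<theta>] by simp
next
  case False
  define y where "y = - \<theta>"
  have y: "0 \<le> y" "y \<le> 1" using False assms by (auto simp: y_def)
  have pos: "0 \<le> 1 - y + y\<^sup>2" using y by simp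
  \<comment> \<open>Since \<open>exp y\<close> dominates the second factor, it suffices that this
    product is at least 1; then \<open>1 - y + y\<^sup>2\<close> is at least the reciprocal
    \<open>exp (- y)\<close>.\<close>
  have "1 \<le> (1 - y + y\<^sup>2) * (1 + y + y\<^sup>2 / 2)"
  proof -
    have "(1 - y + y\<^sup>2) * (1 + y + y\<^sup>2 / 2) = 1 + y\<^sup>2 / 2 + y ^ 3 / 2 + y ^ 4 / 2"
      by (simp add: field_simps power2_eq_square power3_eq_cube power4_eq_xxxx)
    then show ?thesis using y by simp
  qed
  also have "\<dots> \<le> (1 - y + y\<^sup>2) * exp y"
    using pos exp_lower_Taylor_quadratic[of y] y by (intro mult_left_mono) auto
  finally have "exp (- y) \<le> 1 - y + y\<^sup>2" by (simp add: exp_minus field_simps)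
  then show ?thesis by (simp add: y_def)
qed

text \<open>The left side is the moment generating function of a centered Bernoulli variable. Its
  bound is free of \<open>q\<close>, because the conditional success probability is random and the
  factor must come out of an integral.\<close>

lemma centered_bernoulli_mgf_le:
  fixes q \<theta> :: real
  assumes "0 \<le> q" "q \<le> 1" "\<bar>\<theta>\<bar> \<le> 1"
  shows "exp (- \<theta> * q) * (exp \<theta> * q + (1 - q)) \<le> exp (\<theta>\<^sup>2)"
proof -
  have "exp \<theta> * q + (1 - q) = 1 + q * (exp \<theta> - 1)" by (simp add: algebra_simps)
  also have "\<dots> \<le> exp (q * (exp \<theta> - 1))" by (rule exp_ge_add_one_self)
  also have "\<dots> \<le> exp (q * (\<theta> + \<theta>\<^sup>2))"
    using exp_le_quadratic[OF assms(3)] assms by (simp add: mult_left_mono)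
  finally have "exp (- \<theta> * q) * (exp \<theta> * q + (1 - q)) \<le> exp (- \<theta> * q) * exp (q * (\<theta> + \<theta>\<^sup>2))"
    by (intro mult_left_mono) auto
  also have "\<dots> = exp (q * \<theta>\<^sup>2)" by (simp add: exp_add[symmetric] algebra_simps)
  also have "\<dots> \<le> exp (\<theta>\<^sup>2)" using assms by (simp add: mult_left_le_one_le)
  finally show ?thesis .
qed

text \<open>The past as a random variable with values in a countable type, so that it has atoms to
  condition on. The first list has \<open>Suc n\<close> entries because the arrivals of slot
  \<open>n\<close> precede its attempts.\<close>

definition hist ::
    "(nat \<Rightarrow> 'w \<Rightarrow> nat ^ 'k) \<Rightarrow> (nat ^ 'k \<Rightarrow> nat \<Rightarrow> 'w \<Rightarrow> nat ^ 'k) \<Rightarrow> nat ^ 'k \<Rightarrow> nat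
       \<Rightarrow> 'w \<Rightarrow> (nat ^ 'k) list \<times> (nat ^ 'k::finite) list" where
  "hist A N x n \<omega> = (map (\<lambda>m. A m \<omega>) [0..<Suc n], map (\<lambda>m. N x m \<omega>) [0..<n])"

lemma hist_eq_iff:
  "hist A N x n \<omega> = hist A N x n \<omega>' \<longleftrightarrow> history A N x n (\<lambda>m. A m \<omega>') (\<lambda>m. N x m \<omega>') \<omega>"
  by (auto simp: hist_def history_def less_Suc_eq_le simp del: upt_Suc)

lemma hist_eq_prefix:
  assumes "hist A N x n \<omega> = hist A N x n \<omega>'" "m \<le> n"
  shows "hist A N x m \<omega> = hist A N x m \<omega>'"
  using assms by (auto simp: hist_eq_iff history_def)

lemma users_cong_hist:
  "hist A N x n \<omega> = hist A N x n \<omega>' \<Longrightarrow> users E A N x n \<omega> = users E A N x n \<omega>'"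
proof (induction n)
  case (Suc n)
  have "users E A N x n \<omega> = users E A N x n \<omega>'"
    using Suc.IH hist_eq_prefix[OF Suc.prems, of n] by simp
  moreover have "N x n \<omega> = N x n \<omega>'" "A (Suc n) \<omega> = A (Suc n) \<omega>'"
    using Suc.prems by (auto simp: hist_eq_iff history_def)
  ultimately show ?case by simp
qed simp

definition departure_noise ::
    "('k \<times> 'k) set \<Rightarrow> (nat \<Rightarrow> 'w \<Rightarrow> nat ^ 'k) \<Rightarrow> (nat ^ 'k \<Rightarrow> nat \<Rightarrow> 'w \<Rightarrow> nat ^ 'k)
       \<Rightarrow> 'k \<Rightarrow> nat ^ 'k \<Rightarrow> nat \<Rightarrow> 'w \<Rightarrow> real" where
  "departure_noise E A N i x n \<omega> =
     (\<Sum>m<n. of_bool (success E i (N x m \<omega>)) - success_prob E i (users E A N x m (\<omega> :: 'w) :: nat ^ 'k::finite))"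

lemma departure_noise_cong_hist:
  assumes "hist A N x n \<omega> = hist A N x n \<omega>'"
  shows "departure_noise E A N i x n \<omega> = departure_noise E A N i x n \<omega>'"
  unfolding departure_noise_def
proof (rule sum.cong)
  fix m assume "m \<in> {..<n}"
  then have "users E A N x m \<omega> = users E A N x m \<omega>'" "N x m \<omega> = N x m \<omega>'"
    using users_cong_hist[OF hist_eq_prefix[OF assms, of m]] assms by (auto simp: hist_eq_iff history_def)
  then show "of_bool (success E i (N x m \<omega>)) - success_prob E i (users E A N x m \<omega>)
    = of_bool (success E i (N x m \<omega>')) - success_prob E i (users E A N x m \<omega>')" by simp
qed simp

section \<open>Conditioning on the discrete past\<close>

context random_access_model
begin

lemma A_measurable [measurable]: "A n \<in> measurable M (count_space UNIV)"
  using arrivals_indep by (auto simp: indep_vars_def)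

lemma N_measurable [measurable]: "N x n \<in> measurable M (count_space UNIV)"
  by (rule attempts_measurable)

lemma hist_measurable [measurable]: "hist A N x n \<in> measurable M (count_space UNIV)"
proof (subst measurable_count_space_eq2_countable, intro conjI ballI)
  fix h :: "(nat ^ 'k) list \<times> (nat ^ 'k) list"
  show "hist A N x n -` {h} \<inter> space M \<in> sets M"
  proof (cases "\<exists>\<omega>. hist A N x n \<omega> = h")
    case True
    then obtain \<omega>' where "h = hist A N x n \<omega>'" by blast
    then have "hist A N x n -` {h} \<inter> space M = {\<omega> \<in> space M.
        (\<forall>m\<in>{..n}. A m \<omega> = A m \<omega>') \<and> (\<forall>m\<in>{..<n}. N x m \<omega> = N x m \<omega>')}"
      by (auto simp: hist_eq_iff history_def)
    also have "\<dots> \<in> sets M" by measurable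
    finally show ?thesis .
  next
    case False
    then have "hist A N x n -` {h} \<inter> space M = {}" by blast
    then show ?thesis by simp
  qed
qed auto

text \<open>Constancy on the fibres of \<open>hist\<close> stands in for measurability with respect
  to the past: such a function factors through a countable discrete type.\<close>

lemma measurable_of_cong_hist:
  assumes "\<And>\<omega> \<omega>'. hist A N x n \<omega> = hist A N x n \<omega>' \<Longrightarrow> F \<omega> = F \<omega>'"
    and "\<And>\<omega>. F \<omega> \<in> space K"
  shows "F \<in> measurable M K"
proof -
  have "F = (\<lambda>h. F (SOME \<omega>. hist A N x n \<omega> = h)) \<circ> hist A N x n"
  proof
    fix \<omega>
    have "hist A N x n (SOME \<omega>'. hist A N x n \<omega>' = hist A N x n \<omega>) = hist A N x n \<omega>"
      by (rule someI) simp
    from assms(1)[OF this] show "F \<omega> = ((\<lambda>h. F (SOME \<omega>. hist A N x n \<omega> = h)) \<circ> hist A N x n) \<omega>"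
      by simp
  qed
  moreover have "(\<lambda>h. F (SOME \<omega>. hist A N x n \<omega> = h)) \<in> measurable (count_space UNIV) K"
    using assms(2) by (simp add: measurable_count_space_eq1)
  ultimately show ?thesis
    using measurable_comp[OF hist_measurable] by metis
qed

lemma users_measurable [measurable]: "users E A N x n \<in> measurable M (count_space UNIV)"
  by (rule measurable_of_cong_hist) (rule users_cong_hist, simp_all)

text \<open>The conditioning event of \<open>attempts_law\<close> also fixes \<open>users\<close>,
  but the past determines that value, so the event is an atom of \<open>hist\<close>. On null atoms,
  about which the law says nothing, both sides vanish.\<close>

lemma emeasure_attempt_singleton:
  "emeasure M {\<omega> \<in> space M. hist A N x n \<omega> = hist A N x n \<omega>' \<and> N x n \<omega> = k} =
     emeasure M {\<omega> \<in> space M. hist A N x n \<omega> = hist A N x n \<omega>'}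
     * ennreal (pmf (attempt_pmf E (users E A N x n \<omega>')) k)"
proof -
  let ?H = "\<lambda>\<omega>. history A N x n (\<lambda>m. A m \<omega>') (\<lambda>m. N x m \<omega>') \<omega> \<and> users E A N x n \<omega> = users E A N x n \<omega>'"
  have H: "hist A N x n \<omega> = hist A N x n \<omega>' \<longleftrightarrow> ?H \<omega>" for \<omega>
    unfolding hist_eq_iff[symmetric] using users_cong_hist[of A N x n \<omega> \<omega>' E] by blast
  have "prob {\<omega> \<in> space M. hist A N x n \<omega> = hist A N x n \<omega>' \<and> N x n \<omega> = k} =
     prob {\<omega> \<in> space M. hist A N x n \<omega> = hist A N x n \<omega>'} * pmf (attempt_pmf E (users E A N x n \<omega>')) k"
  proof (cases "prob {\<omega> \<in> space M. hist A N x n \<omega> = hist A N x n \<omega>'} = 0")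
    case True
    have "prob {\<omega> \<in> space M. hist A N x n \<omega> = hist A N x n \<omega>' \<and> N x n \<omega> = k}
        \<le> prob {\<omega> \<in> space M. hist A N x n \<omega> = hist A N x n \<omega>'}"
      by (rule finite_measure_mono) (auto, measurable)
    then show ?thesis using True by (simp add: measure_le_0_iff)
  next
    case False
    then have pos: "0 < prob {\<omega> \<in> space M. ?H \<omega>}" by (simp add: H zero_less_measure_iff)
    have "\<P>(\<omega> in M. N x n \<omega> = k \<bar> ?H \<omega>) = pmf (attempt_pmf E (users E A N x n \<omega>')) k"
      unfolding pmf_attempt by (rule attempts_law[OF pos])
    then show ?thesis
      using pos by (simp add: cond_prob_def H field_simps conj_commute conj_left_commute)
  qed
  then show ?thesis by (simp add: emeasure_eq_measure ennreal_mult)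
qed

lemma emeasure_attempt:
  "emeasure M {\<omega> \<in> space M. hist A N x n \<omega> = hist A N x n \<omega>' \<and> N x n \<omega> \<in> B} =
     emeasure M {\<omega> \<in> space M. hist A N x n \<omega> = hist A N x n \<omega>'}
     * emeasure (attempt_pmf E (users E A N x n \<omega>')) B"
proof -
  let ?H = "\<lambda>k. {\<omega> \<in> space M. hist A N x n \<omega> = hist A N x n \<omega>' \<and> N x n \<omega> = k}"
  have "{\<omega> \<in> space M. hist A N x n \<omega> = hist A N x n \<omega>' \<and> N x n \<omega> \<in> B} = (\<Union>k\<in>B. ?H k)" by auto
  then have "emeasure M {\<omega> \<in> space M. hist A N x n \<omega> = hist A N x n \<omega>' \<and> N x n \<omega> \<in> B}
      = (\<integral>\<^sup>+k. emeasure M (?H k) \<partial>count_space B)"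
    by (simp only:) (rule emeasure_UN_countable, auto simp: disjoint_family_on_def, measurable)
  also have "\<dots> = (\<integral>\<^sup>+k. emeasure M {\<omega> \<in> space M. hist A N x n \<omega> = hist A N x n \<omega>'}
     * ennreal (pmf (attempt_pmf E (users E A N x n \<omega>')) k) \<partial>count_space B)"
    by (simp only: emeasure_attempt_singleton)
  also have "\<dots> = emeasure M {\<omega> \<in> space M. hist A N x n \<omega> = hist A N x n \<omega>'}
     * emeasure (attempt_pmf E (users E A N x n \<omega>')) B"
    by (simp add: nn_integral_cmult nn_integral_pmf)
  finally show ?thesis .
qed

lemma nn_integral_partition_hist:
  assumes [measurable]: "G \<in> borel_measurable M"
  shows "(\<integral>\<^sup>+\<omega>. G \<omega> \<partial>M) =
    (\<integral>\<^sup>+h. (\<integral>\<^sup>+\<omega>. G \<omega> * indicator {h} (hist A N x n \<omega>) \<partial>M) \<partial>count_space UNIV)"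
proof -
  have "(\<integral>\<^sup>+h. (\<integral>\<^sup>+\<omega>. G \<omega> * indicator {h} (hist A N x n \<omega>) \<partial>M) \<partial>count_space UNIV) =
    (\<integral>\<^sup>+\<omega>. (\<integral>\<^sup>+h. G \<omega> * indicator {h} (hist A N x n \<omega>) \<partial>count_space UNIV) \<partial>M)"
    by (rule nn_integral_count_space_nn_integral[symmetric]) auto
  also have "\<dots> = (\<integral>\<^sup>+\<omega>. G \<omega> \<partial>M)"
  proof (rule nn_integral_cong)
    fix \<omega>
    have "(\<integral>\<^sup>+h. G \<omega> * indicator {h} (hist A N x n \<omega>) \<partial>count_space UNIV)
        = (\<integral>\<^sup>+h. G \<omega> * indicator {hist A N x n \<omega>} h \<partial>count_space UNIV)"
      by (rule nn_integral_cong) (auto simp: indicator_def)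
    also have "\<dots> = G \<omega>" by (simp add: nn_integral_cmult)
    finally show "(\<integral>\<^sup>+h. G \<omega> * indicator {h} (hist A N x n \<omega>) \<partial>count_space UNIV) = G \<omega>" .
  qed
  finally show ?thesis by simp
qed

text \<open>An elementary tower property: on each atom of the past \<open>F\<close> and
  \<open>B\<close> are constant, \<open>emeasure_attempt\<close> applies, and the atoms are summed.
  A set \<open>B\<close> depending on the past permits comparing \<open>N x n\<close> with the
  current state.\<close>

lemma nn_integral_attempt:
  fixes F :: "'w \<Rightarrow> ennreal" and B :: "'w \<Rightarrow> (nat ^ 'k) set"
  assumes F: "\<And>\<omega> \<omega>'. hist A N x n \<omega> = hist A N x n \<omega>' \<Longrightarrow> F \<omega> = F \<omega>'"
    and B: "\<And>\<omega> \<omega>'. hist A N x n \<omega> = hist A N x n \<omega>' \<Longrightarrow> B \<omega> = B \<omega>'"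
  shows "(\<integral>\<^sup>+\<omega>. F \<omega> * indicator (B \<omega>) (N x n \<omega>) \<partial>M) =
    (\<integral>\<^sup>+\<omega>. F \<omega> * emeasure (attempt_pmf E (users E A N x n \<omega>)) (B \<omega>) \<partial>M)"
proof -
  have mF [measurable]: "F \<in> borel_measurable M"
    by (rule measurable_of_cong_hist[OF F]) simp_all
  have mB [measurable]: "Measurable.pred M (\<lambda>\<omega>. k \<in> B \<omega>)" for k
    by (rule measurable_of_cong_hist[of x n]) (drule B, simp_all)
  have "Measurable.pred M (\<lambda>\<omega>. \<exists>k. N x n \<omega> = k \<and> k \<in> B \<omega>)"
    by measurable
  then have pB [measurable]: "Measurable.pred M (\<lambda>\<omega>. N x n \<omega> \<in> B \<omega>)"
    by simp
  have ind [measurable]: "(\<lambda>\<omega>. indicator (B \<omega>) (N x n \<omega>) :: ennreal) \<in> borel_measurable M"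
  proof -
    have "(\<lambda>\<omega>. if N x n \<omega> \<in> B \<omega> then 1 else 0 :: ennreal) \<in> borel_measurable M"
      by measurable
    then show ?thesis by (simp add: indicator_def of_bool_def)
  qed
  have em [measurable]: "(\<lambda>\<omega>. emeasure (attempt_pmf E (users E A N x n \<omega>)) (B \<omega>)) \<in> borel_measurable M"
    by (rule measurable_of_cong_hist[of x n]) (metis users_cong_hist B, simp)
  have key: "(\<integral>\<^sup>+\<omega>. (F \<omega> * indicator (B \<omega>) (N x n \<omega>)) * indicator {h} (hist A N x n \<omega>) \<partial>M) =
    (\<integral>\<^sup>+\<omega>. (F \<omega> * emeasure (attempt_pmf E (users E A N x n \<omega>)) (B \<omega>)) * indicator {h} (hist A N x n \<omega>) \<partial>M)"
    for h
  proof (cases "\<exists>\<omega>'. hist A N x n \<omega>' = h")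
    case True
    then obtain \<omega>' where h: "h = hist A N x n \<omega>'" by blast
    have "(\<integral>\<^sup>+\<omega>. (F \<omega> * indicator (B \<omega>) (N x n \<omega>)) * indicator {h} (hist A N x n \<omega>) \<partial>M) =
      (\<integral>\<^sup>+\<omega>. F \<omega>' * indicator {\<omega> \<in> space M. hist A N x n \<omega> = hist A N x n \<omega>' \<and> N x n \<omega> \<in> B \<omega>'} \<omega> \<partial>M)"
    proof (rule nn_integral_cong)
      fix \<omega> assume "\<omega> \<in> space M"
      then show "(F \<omega> * indicator (B \<omega>) (N x n \<omega>)) * indicator {h} (hist A N x n \<omega>)
        = F \<omega>' * indicator {\<omega> \<in> space M. hist A N x n \<omega> = hist A N x n \<omega>' \<and> N x n \<omega> \<in> B \<omega>'} \<omega>"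
        using F[of \<omega> \<omega>'] B[of \<omega> \<omega>'] by (cases "hist A N x n \<omega> = hist A N x n \<omega>'") (simp_all add: h indicator_def)
    qed
    also have "\<dots> = F \<omega>' * emeasure M {\<omega> \<in> space M. hist A N x n \<omega> = hist A N x n \<omega>' \<and> N x n \<omega> \<in> B \<omega>'}"
      by (rule nn_integral_cmult_indicator) measurable
    also have "\<dots> = (F \<omega>' * emeasure (attempt_pmf E (users E A N x n \<omega>')) (B \<omega>'))
        * emeasure M {\<omega> \<in> space M. hist A N x n \<omega> = hist A N x n \<omega>'}"
      by (simp only: emeasure_attempt mult_ac)
    also have "\<dots> = (\<integral>\<^sup>+\<omega>. (F \<omega>' * emeasure (attempt_pmf E (users E A N x n \<omega>')) (B \<omega>'))
        * indicator {\<omega> \<in> space M. hist A N x n \<omega> = hist A N x n \<omega>'} \<omega> \<partial>M)"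
      by (rule nn_integral_cmult_indicator[symmetric]) measurable
    also have "\<dots> = (\<integral>\<^sup>+\<omega>. (F \<omega> * emeasure (attempt_pmf E (users E A N x n \<omega>)) (B \<omega>)) * indicator {h} (hist A N x n \<omega>) \<partial>M)"
    proof (rule nn_integral_cong)
      fix \<omega> assume "\<omega> \<in> space M"
      then show "(F \<omega>' * emeasure (attempt_pmf E (users E A N x n \<omega>')) (B \<omega>'))
        * indicator {\<omega> \<in> space M. hist A N x n \<omega> = hist A N x n \<omega>'} \<omega>
        = (F \<omega> * emeasure (attempt_pmf E (users E A N x n \<omega>)) (B \<omega>)) * indicator {h} (hist A N x n \<omega>)"
        using F[of \<omega> \<omega>'] B[of \<omega> \<omega>'] users_cong_hist[of A N x n \<omega> \<omega>' E]
        by (cases "hist A N x n \<omega> = hist A N x n \<omega>'") (simp_all add: h indicator_def)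
    qed
    finally show ?thesis .
  next
    case False
    then have "hist A N x n \<omega> \<noteq> h" for \<omega> by blast
    then show ?thesis by simp
  qed
  have "(\<integral>\<^sup>+\<omega>. F \<omega> * indicator (B \<omega>) (N x n \<omega>) \<partial>M) = (\<integral>\<^sup>+h. (\<integral>\<^sup>+\<omega>. (F \<omega> * indicator (B \<omega>) (N x n \<omega>))
      * indicator {h} (hist A N x n \<omega>) \<partial>M) \<partial>count_space UNIV)"
    by (rule nn_integral_partition_hist) measurable
  also have "\<dots> = (\<integral>\<^sup>+h. (\<integral>\<^sup>+\<omega>. (F \<omega> * emeasure (attempt_pmf E (users E A N x n \<omega>)) (B \<omega>))
      * indicator {h} (hist A N x n \<omega>) \<partial>M) \<partial>count_space UNIV)"
    by (simp only: key)
  also have "\<dots> = (\<integral>\<^sup>+\<omega>. F \<omega> * emeasure (attempt_pmf E (users E A N x n \<omega>)) (B \<omega>) \<partial>M)"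
    by (rule nn_integral_partition_hist[symmetric]) measurable
  finally show ?thesis .
qed

text \<open>A binomial variable never exceeds its number of trials. This rules out truncation in the
  recursion for \<open>users\<close>, simultaneously for the countably many triples
  \<open>x\<close>, \<open>n\<close>, \<open>i\<close>.\<close>

lemma AE_attempts_le_users: "AE \<omega> in M. \<forall>x n i. N x n \<omega> $ i \<le> users E A N x n \<omega> $ i"
proof -
  have "AE \<omega> in M. N x n \<omega> $ i \<le> users E A N x n \<omega> $ i" for x n i
  proof -
    define B where "B = (\<lambda>\<omega>. {k :: nat ^ 'k. users E A N x n \<omega> $ i < k $ i})"
    have B: "hist A N x n \<omega> = hist A N x n \<omega>' \<Longrightarrow> B \<omega> = B \<omega>'" for \<omega> \<omega>'
      unfolding B_def by (drule users_cong_hist[where E = E]) simp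
    have "emeasure (attempt_pmf E w) {k. w $ i < k $ i} = 0" for w
    proof -
      have "pmf (attempt_pmf E w) k = 0" if "w $ i < k $ i" for k
        unfolding pmf_attempt using that attempt_prob_in_0_1[of w E i]
        by (intro prod_zero bexI[of _ i]) (auto simp: binomial_eq_0)
      then have "set_pmf (attempt_pmf E w) \<inter> {k. w $ i < k $ i} = {}"
        by (auto simp: set_pmf_iff)
      then show ?thesis by (simp add: measure_pmf.emeasure_eq_measure measure_pmf_zero_iff)
    qed
    then have "(\<integral>\<^sup>+\<omega>. 1 * indicator (B \<omega>) (N x n \<omega>) \<partial>M) = 0"
      using nn_integral_attempt[of x n "\<lambda>_. 1" B, OF refl B] by (simp add: B_def)
    moreover have "(\<lambda>\<omega>. indicator (B \<omega>) (N x n \<omega>) :: ennreal) \<in> borel_measurable M"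
      unfolding B_def indicator_def by simp measurable
    ultimately have "AE \<omega> in M. (indicator (B \<omega>) (N x n \<omega>) :: ennreal) = 0"
      by (subst (asm) nn_integral_0_iff_AE) auto
    then show ?thesis by eventually_elim (auto simp: B_def indicator_def split: if_splits)
  qed
  then show ?thesis by (simp add: AE_all_countable)
qed

section \<open>Exponential moments of the compensated departures\<close>

lemma departure_noise_measurable [measurable]: "departure_noise E A N i x n \<in> borel_measurable M"
  unfolding departure_noise_def
  by (intro borel_measurable_sum borel_measurable_diff measurable_compose[OF N_measurable]
      measurable_compose[OF users_measurable]) simp_all

text \<open>Each slot multiplies the exponential by a centered Bernoulli factor whose conditional
  mean is at most \<open>exp (\<theta>\<^sup>2)\<close> whatever the state.\<close>

lemma departure_noise_mgf_le:
  assumes "\<bar>\<theta>\<bar> \<le> 1"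
  shows "(\<integral>\<^sup>+\<omega>. ennreal (exp (\<theta> * departure_noise E A N i x n \<omega>)) \<partial>M) \<le> ennreal (exp (real n * \<theta>\<^sup>2))"
proof (induction n)
  case 0
  then show ?case by (simp add: departure_noise_def emeasure_space_1)
next
  case (Suc n)
  define Z where "Z = departure_noise E A N i x n"
  define q where "q = (\<lambda>\<omega>. success_prob E i (users E A N x n \<omega>))"
  \<comment> \<open>The compensator of slot \<open>n\<close> belongs to \<open>F\<close>, as it
    depends on the past only; what remains is a factor \<open>exp \<theta>\<close> on success and 1
    otherwise.\<close>
  define F where "F = (\<lambda>\<omega>. ennreal (exp (\<theta> * Z \<omega> - \<theta> * q \<omega>)))"
  let ?B = "{k. success E i k}"
  have cong: "hist A N x n \<omega> = hist A N x n \<omega>' \<Longrightarrow> F \<omega> = F \<omega>'" for \<omega> \<omega>'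
    unfolding F_def Z_def q_def
    by (simp only: departure_noise_cong_hist[of A N x n \<omega> \<omega>'] users_cong_hist[of A N x n \<omega> \<omega>'])
  have [measurable]: "F \<in> borel_measurable M"
    by (rule measurable_of_cong_hist[OF cong]) simp_all
  have q_measurable [measurable]: "q \<in> borel_measurable M"
    unfolding q_def by (rule measurable_compose[OF users_measurable]) simp
  have em: "emeasure (attempt_pmf E w) ?B = ennreal (success_prob E i w)"
      "emeasure (attempt_pmf E w) (- ?B) = ennreal (1 - success_prob E i w)" for w
    using measure_pmf.prob_compl[of ?B "attempt_pmf E w"]
    by (simp_all add: success_prob_def measure_pmf.emeasure_eq_measure Compl_eq_Diff_UNIV)
  have "(\<integral>\<^sup>+\<omega>. ennreal (exp (\<theta> * departure_noise E A N i x (Suc n) \<omega>)) \<partial>M) =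
      (\<integral>\<^sup>+\<omega>. ennreal (exp \<theta>) * (F \<omega> * indicator ?B (N x n \<omega>)) + F \<omega> * indicator (- ?B) (N x n \<omega>) \<partial>M)"
    by (intro nn_integral_cong)
       (auto simp: F_def Z_def q_def departure_noise_def indicator_def ennreal_mult[symmetric]
          exp_add[symmetric] algebra_simps)
  also have "\<dots> = ennreal (exp \<theta>) * (\<integral>\<^sup>+\<omega>. F \<omega> * indicator ?B (N x n \<omega>) \<partial>M)
      + (\<integral>\<^sup>+\<omega>. F \<omega> * indicator (- ?B) (N x n \<omega>) \<partial>M)"
    by (subst nn_integral_add) (auto simp: nn_integral_cmult)
  also have "\<dots> = ennreal (exp \<theta>) * (\<integral>\<^sup>+\<omega>. F \<omega> * ennreal (q \<omega>) \<partial>M)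
      + (\<integral>\<^sup>+\<omega>. F \<omega> * ennreal (1 - q \<omega>) \<partial>M)"
    using nn_integral_attempt[of x n F "\<lambda>_. ?B", OF cong refl]
      nn_integral_attempt[of x n F "\<lambda>_. - ?B", OF cong refl]
    by (simp add: em q_def)
  also have "\<dots> = (\<integral>\<^sup>+\<omega>. ennreal (exp \<theta>) * (F \<omega> * ennreal (q \<omega>)) + F \<omega> * ennreal (1 - q \<omega>) \<partial>M)"
    by (subst nn_integral_add) (auto simp: nn_integral_cmult q_def)
  also have "\<dots> \<le> (\<integral>\<^sup>+\<omega>. ennreal (exp (\<theta> * Z \<omega>)) * ennreal (exp (\<theta>\<^sup>2)) \<partial>M)"
  proof (rule nn_integral_mono)
    fix \<omega>
    have q: "0 \<le> q \<omega>" "q \<omega> \<le> 1" by (auto simp: q_def success_prob_bounds)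
    have "exp \<theta> * (exp (\<theta> * Z \<omega> - \<theta> * q \<omega>) * q \<omega>) + exp (\<theta> * Z \<omega> - \<theta> * q \<omega>) * (1 - q \<omega>)
      = exp (\<theta> * Z \<omega>) * (exp (- \<theta> * q \<omega>) * (exp \<theta> * q \<omega> + (1 - q \<omega>)))"
      by (simp add: exp_diff exp_minus field_simps)
    also have "\<dots> \<le> exp (\<theta> * Z \<omega>) * exp (\<theta>\<^sup>2)"
      using centered_bernoulli_mgf_le[OF q assms] by (intro mult_left_mono) auto
    finally show "ennreal (exp \<theta>) * (F \<omega> * ennreal (q \<omega>)) + F \<omega> * ennreal (1 - q \<omega>)
        \<le> ennreal (exp (\<theta> * Z \<omega>)) * ennreal (exp (\<theta>\<^sup>2))"
      using q by (simp add: F_def ennreal_mult[symmetric] ennreal_plus[symmetric] del: ennreal_plus)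
  qed
  also have "\<dots> = (\<integral>\<^sup>+\<omega>. ennreal (exp (\<theta> * Z \<omega>)) \<partial>M) * ennreal (exp (\<theta>\<^sup>2))"
    by (rule nn_integral_multc) (auto simp: Z_def)
  also have "\<dots> \<le> ennreal (exp (real n * \<theta>\<^sup>2)) * ennreal (exp (\<theta>\<^sup>2))"
    using Suc by (intro mult_right_mono) (auto simp: Z_def)
  also have "\<dots> = ennreal (exp (real (Suc n) * \<theta>\<^sup>2))"
    by (simp add: ennreal_mult[symmetric] exp_add[symmetric] algebra_simps)
  finally show ?case .
qed

text \<open>Chernoff's bound for both signs at once: \<open>exp (\<theta> * \<bar>Z\<bar>)\<close>
  is at most the sum of the exponentials with \<open>\<theta>\<close> and \<open>- \<theta>\<close>,
  whence the factor 2.\<close>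

lemma prob_departure_noise_ge:
  assumes \<theta>: "0 \<le> \<theta>" "\<theta> \<le> 1"
  shows "prob {\<omega> \<in> space M. c \<le> \<bar>departure_noise E A N i x n \<omega>\<bar>} \<le> 2 * exp (real n * \<theta>\<^sup>2 - \<theta> * c)"
proof -
  let ?Z = "departure_noise E A N i x n"
  let ?S = "{\<omega> \<in> space M. c \<le> \<bar>?Z \<omega>\<bar>}"
  have "emeasure M ?S = (\<integral>\<^sup>+\<omega>. indicator ?S \<omega> \<partial>M)" by simp
  also have "\<dots> \<le> (\<integral>\<^sup>+\<omega>. ennreal (exp (- \<theta> * c)) *
      (ennreal (exp (\<theta> * ?Z \<omega>)) + ennreal (exp (- \<theta> * ?Z \<omega>))) \<partial>M)"
  proof (rule nn_integral_mono)
    fix \<omega>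
    have "1 \<le> exp (- \<theta> * c) * (exp (\<theta> * ?Z \<omega>) + exp (- \<theta> * ?Z \<omega>))" if "c \<le> \<bar>?Z \<omega>\<bar>"
    proof -
      have "1 \<le> exp (\<theta> * (\<bar>?Z \<omega>\<bar> - c))" using that \<theta> by simp
      also have "\<dots> = exp (- \<theta> * c) * exp (\<theta> * \<bar>?Z \<omega>\<bar>)"
        by (simp add: exp_add[symmetric] algebra_simps)
      also have "exp (\<theta> * \<bar>?Z \<omega>\<bar>) \<le> exp (\<theta> * ?Z \<omega>) + exp (- \<theta> * ?Z \<omega>)"
        by (cases "0 \<le> ?Z \<omega>") auto
      finally show ?thesis by simp
    qed
    then show "indicator ?S \<omega> \<le> ennreal (exp (- \<theta> * c)) *
      (ennreal (exp (\<theta> * ?Z \<omega>)) + ennreal (exp (- \<theta> * ?Z \<omega>)))"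
      by (auto simp: indicator_def ennreal_mult[symmetric] ennreal_plus[symmetric]
          ennreal_1[symmetric] simp del: ennreal_plus ennreal_1)
  qed
  also have "\<dots> = ennreal (exp (- \<theta> * c)) * ((\<integral>\<^sup>+\<omega>. ennreal (exp (\<theta> * ?Z \<omega>)) \<partial>M)
      + (\<integral>\<^sup>+\<omega>. ennreal (exp (- \<theta> * ?Z \<omega>)) \<partial>M))"
    by (subst nn_integral_cmult) (auto simp: nn_integral_add)
  also have "\<dots> \<le> ennreal (exp (- \<theta> * c)) * (ennreal (exp (real n * \<theta>\<^sup>2)) + ennreal (exp (real n * \<theta>\<^sup>2)))"
    using departure_noise_mgf_le[of \<theta> i x n] departure_noise_mgf_le[of "- \<theta>" i x n] \<theta>
    by (intro mult_left_mono add_mono) auto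
  also have "\<dots> = ennreal (2 * exp (real n * \<theta>\<^sup>2 - \<theta> * c))"
    by (simp add: ennreal_mult[symmetric] ennreal_plus[symmetric] exp_diff exp_minus field_simps
        del: ennreal_plus)
  finally show ?thesis by (simp add: emeasure_eq_measure)
qed

end

section \<open>Almost sure drift estimates\<close>

lemma finite_total: "finite {x :: nat ^ 'k::finite. total x = r}"
  and card_total_le: "card {x :: nat ^ 'k. total x = r} \<le> (r + 1) ^ CARD('k)"
proof -
  let ?S = "{x :: nat ^ 'k. total x = r}"
  have sub: "vec_nth ` ?S \<subseteq> PiE UNIV (\<lambda>_. {..r})"
  proof
    fix f assume "f \<in> vec_nth ` ?S"
    then obtain x :: "nat ^ 'k" where x: "f = vec_nth x" "total x = r" by auto
    have "x $ i \<le> r" for i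
      using member_le_sum[of i UNIV "vec_nth x"] x(2) by (simp add: total_def)
    then show "f \<in> PiE UNIV (\<lambda>_. {..r})" by (auto simp: x)
  qed
  have fin: "finite (PiE (UNIV :: 'k set) (\<lambda>_. {..r}))" by (rule finite_PiE) auto
  have inj: "inj_on vec_nth ?S" by (auto simp: inj_on_def vec_nth_inject)
  show "finite ?S" using finite_imageD[OF finite_subset[OF sub fin] inj] .
  have "card ?S = card (vec_nth ` ?S)" by (rule card_image[OF inj, symmetric])
  also have "\<dots> \<le> card (PiE (UNIV :: 'k set) (\<lambda>_. {..r}))" by (rule card_mono[OF fin sub])
  also have "\<dots> = (r + 1) ^ CARD('k)" by (simp add: card_PiE)
  finally show "card ?S \<le> (r + 1) ^ CARD('k)" .
qed

text \<open>Half of the exponential absorbs the polynomial; the other half is a geometric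
  series.\<close>

lemma summable_power_times_exp:
  fixes c :: real
  assumes "0 < c"
  shows "summable (\<lambda>r. real (r + 1) ^ m * exp (- c * real r))"
proof (rule summable_comparison_test_bigo)
  have "exp (- c / 2) < 1" using assms by simp
  then have "summable (\<lambda>r. exp (- c / 2) ^ r)" by (intro summable_geometric) auto
  then show "summable (\<lambda>r. norm (exp (- c / 2 * real r)))"
    by (simp add: exp_of_nat_mult[symmetric] mult.commute)
  show "(\<lambda>r. real (r + 1) ^ m * exp (- c * real r)) \<in> O(\<lambda>r. exp (- c / 2 * real r))"
    using assms by real_asymp
qed

text \<open>From some \<open>n0\<close> on the error is at most \<open>e * n\<close>, and the
  finitely many earlier indices have a common bound \<open>C\<close>, negligible against
  \<open>\<epsilon> * r\<close>. The shift to \<open>a (Suc k)\<close> matches the chain, whose step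
  from \<open>n\<close> to \<open>Suc n\<close> adds \<open>A (Suc n)\<close>.\<close>

lemma eventually_partial_sums_near:
  fixes a :: "nat \<Rightarrow> real"
  assumes lim: "(\<lambda>n. (\<Sum>k<n. a k) / real n) \<longlonglongrightarrow> \<mu>" and \<epsilon>: "0 < \<epsilon>"
  shows "\<forall>\<^sub>F r in sequentially. \<forall>n\<le>T * r. \<bar>(\<Sum>k<n. a (Suc k)) - \<mu> * real n\<bar> \<le> \<epsilon> * real r"
proof -
  define b where "b = (\<lambda>n. (\<Sum>k<n. a (Suc k)))"
  define e where "e = \<epsilon> / (real T + 1)"
  have e: "0 < e" "e * real T \<le> \<epsilon>" using \<epsilon> by (auto simp: e_def field_simps)
  have S: "(\<Sum>k<Suc n. a k) = a 0 + b n" for n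
    unfolding b_def by (rule sum.lessThan_Suc_shift)
  have "(\<lambda>n. (\<Sum>k<Suc n. a k) / real (Suc n) * (real (Suc n) / real n) - a 0 / real n) \<longlonglongrightarrow> \<mu> * 1 - 0"
  proof (intro tendsto_diff tendsto_mult LIMSEQ_Suc[OF lim])
    show "(\<lambda>n. real (Suc n) / real n) \<longlonglongrightarrow> 1" by real_asymp
    show "(\<lambda>n. a 0 / real n) \<longlonglongrightarrow> 0" by real_asymp
  qed
  moreover have "\<forall>\<^sub>F n in sequentially.
      (\<Sum>k<Suc n. a k) / real (Suc n) * (real (Suc n) / real n) - a 0 / real n = b n / real n"
    using eventually_gt_at_top[of 0]
  proof eventually_elim
    case (elim n)
    have "(\<Sum>k<Suc n. a k) / real (Suc n) * (real (Suc n) / real n) = (a 0 + b n) / real n"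
      unfolding S by (simp del: of_nat_Suc)
    then show ?case by (simp add: add_divide_distrib del: of_nat_Suc sum.lessThan_Suc)
  qed
  ultimately have "(\<lambda>n. b n / real n) \<longlonglongrightarrow> \<mu>"
    by (auto elim: Lim_transform_eventually)
  from LIMSEQ_D[OF this e(1)] obtain n0 where n0: "\<And>n. n0 \<le> n \<Longrightarrow> \<bar>b n / real n - \<mu>\<bar> < e" by auto
  have large: "\<bar>b n - \<mu> * real n\<bar> \<le> e * real n" if "n0 \<le> n" for n
  proof (cases "n = 0")
    case False
    then have "b n - \<mu> * real n = (b n / real n - \<mu>) * real n" by (simp add: field_simps)
    then have "\<bar>b n - \<mu> * real n\<bar> = \<bar>b n / real n - \<mu>\<bar> * real n" by (simp add: abs_mult)
    also have "\<dots> \<le> e * real n" using n0[OF that] by (intro mult_right_mono) auto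
    finally show ?thesis .
  qed (simp add: b_def)
  define C where "C = (\<Sum>n<n0. \<bar>b n - \<mu> * real n\<bar>)"
  have small: "\<bar>b n - \<mu> * real n\<bar> \<le> C" if "n < n0" for n
    unfolding C_def using that by (intro member_le_sum) auto
  obtain r0 :: nat where r0: "C / \<epsilon> < real r0" using reals_Archimedean2 by blast
  show ?thesis
    using eventually_ge_at_top[of r0]
  proof eventually_elim
    case (elim r)
    show ?case
    proof (intro allI impI)
      fix n assume n: "n \<le> T * r"
      have "\<bar>b n - \<mu> * real n\<bar> \<le> \<epsilon> * real r"
      proof (cases "n0 \<le> n")
        case True
        have "e * real n \<le> e * (real T * real r)"
          using n e by (intro mult_left_mono) (auto simp flip: of_nat_mult)
        also have "\<dots> \<le> \<epsilon> * real r" using mult_right_mono[OF e(2), of "real r"] by (simp add: mult.assoc)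
        finally show ?thesis using large[OF True] by linarith
      next
        case False
        have "C / \<epsilon> \<le> real r" using r0 elim by linarith
        then have "C \<le> \<epsilon> * real r" using \<epsilon> by (simp add: divide_le_eq mult.commute)
        then show ?thesis using small[of n] False by simp
      qed
      then show "\<bar>(\<Sum>k<n. a (Suc k)) - \<mu> * real n\<bar> \<le> \<epsilon> * real r" by (simp add: b_def)
    qed
  qed
qed

text \<open>Success needs one attempt, hence by the assumption at least one user, so the subtraction
  of naturals is exact and the recursion telescopes over the reals.\<close>

lemma users_eq:
  fixes x :: "nat ^ 'k::finite"
  assumes "\<And>m. N x m \<omega> $ i \<le> users E A N x m \<omega> $ i"
  shows "real (users E A N x n \<omega> $ i) =
    real (x $ i) + (\<Sum>m<n. real (A (Suc m) \<omega> $ i)) - (\<Sum>m<n. of_bool (success E i (N x m \<omega>)))"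
proof (induction n)
  case (Suc n)
  have "of_bool (success E i (N x n \<omega>)) \<le> users E A N x n \<omega> $ i"
    using assms[of n] by (auto simp: success_def)
  then have "real (users E A N x (Suc n) \<omega> $ i) =
      real (users E A N x n \<omega> $ i) + real (A (Suc n) \<omega> $ i) - of_bool (success E i (N x n \<omega>))"
    by (simp only: users.simps vec_lambda_beta of_bool_success) (simp add: of_nat_diff)
  with Suc show ?case by simp
qed simp

context random_access_model
begin

text \<open>
  The subsequence realising a fluid limit is random, hence the estimate has to hold for all initial
  states at once; there are only polynomially many of each size.
\<close>

lemma AE_departure_noise_small:
  assumes \<epsilon>: "0 < \<epsilon>" "\<epsilon> \<le> 1"
  shows "AE \<omega> in M. \<forall>\<^sub>F r in sequentially. \<forall>x :: nat ^ 'k. total x = r \<longrightarrow>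
    (\<forall>n\<le>T * r. \<bar>departure_noise E A N i x n \<omega>\<bar> \<le> \<epsilon> * real r)"
proof -
  \<comment> \<open>Adding 1 gives \<open>1 \<le> T'\<close> even for \<open>T = 0\<close>, which
    together with \<open>\<epsilon> \<le> 1\<close> yields \<open>\<theta> \<le> 1\<close>. The
    exponent \<open>T' * r * \<theta>\<^sup>2 - \<theta> * \<epsilon> * r\<close> is minimal at this
    \<open>\<theta>\<close>, with value \<open>- c * r\<close>.\<close>
  define T' where "T' = real T + 1"
  define \<theta> where "\<theta> = \<epsilon> / (2 * T')"
  define c where "c = \<epsilon>\<^sup>2 / (4 * T')"
  have T': "1 \<le> T'" "real T \<le> T'" by (auto simp: T'_def)
  have \<theta>: "0 \<le> \<theta>" "\<theta> \<le> 1" using \<epsilon> T' by (auto simp: \<theta>_def divide_le_eq)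
  have c: "0 < c" using \<epsilon> T' by (simp add: c_def)
  define D where "D = (\<lambda>r x n. {\<omega> \<in> space M. \<epsilon> * real r \<le> \<bar>departure_noise E A N i x n \<omega>\<bar>})"
  define C where "C = (\<lambda>r. \<Union>x\<in>{x. total x = r}. \<Union>n\<in>{..T * r}. D r x n)"
  have [measurable]: "D r x n \<in> sets M" for r x n unfolding D_def by measurable
  have C_sets: "C r \<in> sets M" for r unfolding C_def by (intro sets.finite_UN finite_total) auto
  have D: "prob (D r x n) \<le> 2 * exp (- c * real r)" if "n \<le> T * r" for r x n
  proof -
    have "real n \<le> real T * real r" using that by (simp flip: of_nat_mult)
    also have "\<dots> \<le> T' * real r" using T' by (intro mult_right_mono) auto
    finally have "real n * \<theta>\<^sup>2 \<le> (T' * real r) * \<theta>\<^sup>2" by (intro mult_right_mono) auto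
    also have "\<dots> - \<theta> * (\<epsilon> * real r) = - c * real r"
      using T' by (simp add: \<theta>_def c_def power2_eq_square field_simps)
    finally have "exp (real n * \<theta>\<^sup>2 - \<theta> * (\<epsilon> * real r)) \<le> exp (- c * real r)" by simp
    with prob_departure_noise_ge[OF \<theta>, of "\<epsilon> * real r" i x n] show ?thesis
      unfolding D_def by linarith
  qed
  \<comment> \<open>The power counts pairs: \<open>CARD('k)\<close> factors for the initial states
    and one more for the times.\<close>
  have C: "prob (C r) \<le> 2 * T' * (real (r + 1) ^ (CARD('k) + 1) * exp (- c * real r))" for r
  proof -
    have inner: "prob (\<Union>n\<in>{..T * r}. D r x n) \<le> T' * real (r + 1) * (2 * exp (- c * real r))" for x
    proof -
      have "prob (\<Union>n\<in>{..T * r}. D r x n) \<le> (\<Sum>n\<in>{..T * r}. prob (D r x n))"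
        by (rule finite_measure_subadditive_finite) auto
      also have "\<dots> \<le> (\<Sum>n\<in>{..T * r}. 2 * exp (- c * real r))"
        by (intro sum_mono D) auto
      also have "\<dots> = (real T * real r + 1) * (2 * exp (- c * real r))" by simp
      also have "\<dots> \<le> T' * real (r + 1) * (2 * exp (- c * real r))"
        by (intro mult_right_mono) (auto simp: T'_def algebra_simps)
      finally show ?thesis .
    qed
    have "prob (C r) \<le> (\<Sum>x | total x = r. prob (\<Union>n\<in>{..T * r}. D r x n))"
      unfolding C_def by (rule finite_measure_subadditive_finite) (auto simp: finite_total)
    also have "\<dots> \<le> (\<Sum>x :: nat ^ 'k | total x = r. T' * real (r + 1) * (2 * exp (- c * real r)))"
      by (intro sum_mono inner)
    also have "\<dots> = real (card {x :: nat ^ 'k. total x = r}) * (T' * real (r + 1) * (2 * exp (- c * real r)))"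
      by simp
    also have "\<dots> \<le> real (r + 1) ^ CARD('k) * (T' * real (r + 1) * (2 * exp (- c * real r)))"
      using T' of_nat_mono[OF card_total_le[where 'k = 'k, of r], where 'a = real]
      by (intro mult_right_mono) auto
    finally show ?thesis by (simp add: mult_ac)
  qed
  have "summable (\<lambda>r. 2 * T' * (real (r + 1) ^ (CARD('k) + 1) * exp (- c * real r)))"
    by (intro summable_mult summable_power_times_exp c)
  then have "summable (\<lambda>r. prob (C r))"
    by (rule summable_comparison_test'[of _ 0]) (simp only: real_norm_def abs_of_nonneg[OF measure_nonneg] C)
  with C_sets have "AE \<omega> in M. \<forall>\<^sub>F r in sequentially. \<omega> \<in> space M - C r"
    by (intro borel_cantelli_AE1) (auto simp: emeasure_eq_measure)
  then show ?thesis
  proof eventually_elim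
    case (elim \<omega>)
    then show ?case
    proof eventually_elim
      case (elim r)
      show ?case
      proof (intro allI impI)
        fix x :: "nat ^ 'k" and n assume "total x = r" "n \<le> T * r"
        with elim have "\<omega> \<in> space M" "\<omega> \<notin> D r x n" by (auto simp: C_def)
        then show "\<bar>departure_noise E A N i x n \<omega>\<bar> \<le> \<epsilon> * real r" by (simp add: D_def)
      qed
    qed
  qed
qed

text \<open>Arrivals and departure noise take half of the tolerance each. Tolerances
  \<open>1 / Suc l\<close> and integer horizons keep the almost sure statement countable; a real
  \<open>\<epsilon>\<close> is recovered pointwise afterwards.\<close>

lemma AE_drift:
  "AE \<omega> in M. \<forall>i T \<epsilon>. 0 < \<epsilon> \<longrightarrow> (\<forall>\<^sub>F r in sequentially. \<forall>x :: nat ^ 'k. total x = r \<longrightarrow> (\<forall>n\<le>T * r.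
    \<bar>real (users E A N x n \<omega> $ i) - real (x $ i) - rate $ i * real n
      + (\<Sum>m<n. success_prob E i (users E A N x m \<omega>))\<bar> \<le> \<epsilon> * real r))"
proof -
  have "AE \<omega> in M. \<forall>i T l. \<forall>\<^sub>F r in sequentially. \<forall>x :: nat ^ 'k. total x = r \<longrightarrow>
    (\<forall>n\<le>T * r. \<bar>departure_noise E A N i x n \<omega>\<bar> \<le> 1 / real (Suc l) * real r)"
    by (simp only: AE_all_countable) (intro allI AE_departure_noise_small, auto)
  moreover have "AE \<omega> in M. \<forall>i. (\<lambda>n. (\<Sum>k<n. real (A k \<omega> $ i)) / real n) \<longlonglongrightarrow> rate $ i"
  proof (simp only: AE_all_countable, intro allI)
    fix i
    have "AE \<omega> in M. (\<lambda>n. (\<Sum>k<n. real (A k \<omega> $ i)) / real n) \<longlonglongrightarrow> expectation (\<lambda>\<omega>. real (A 0 \<omega> $ i))"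
      using arrivals_mean[of 0 i]
      by (intro strong_law_of_large_numbers[OF arrivals_indep arrivals_identical, of "\<lambda>v. real (v $ i)"])
         (auto simp: has_bochner_integral_iff)
    then show "AE \<omega> in M. (\<lambda>n. (\<Sum>k<n. real (A k \<omega> $ i)) / real n) \<longlonglongrightarrow> rate $ i"
      using arrivals_mean[of 0 i] by (simp add: has_bochner_integral_iff)
  qed
  ultimately show ?thesis
    using AE_attempts_le_users
  proof eventually_elim
    case (elim \<omega>)
    show ?case
    proof (intro allI impI)
      fix i T and \<epsilon> :: real assume "0 < \<epsilon>"
      then obtain l where l: "1 / real (Suc l) < \<epsilon> / 2" using nat_approx_posE[of "\<epsilon> / 2"] by auto
      have "\<forall>\<^sub>F r in sequentially. \<forall>n\<le>T * r.
          \<bar>(\<Sum>k<n. real (A (Suc k) \<omega> $ i)) - rate $ i * real n\<bar> \<le> \<epsilon> / 2 * real r"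
        using elim(2) \<open>0 < \<epsilon>\<close> by (intro eventually_partial_sums_near) auto
      moreover have "\<forall>\<^sub>F r in sequentially. \<forall>x :: nat ^ 'k. total x = r \<longrightarrow>
          (\<forall>n\<le>T * r. \<bar>departure_noise E A N i x n \<omega>\<bar> \<le> 1 / real (Suc l) * real r)"
        using elim(1) by blast
      ultimately show "\<forall>\<^sub>F r in sequentially. \<forall>x :: nat ^ 'k. total x = r \<longrightarrow> (\<forall>n\<le>T * r.
        \<bar>real (users E A N x n \<omega> $ i) - real (x $ i) - rate $ i * real n
          + (\<Sum>m<n. success_prob E i (users E A N x m \<omega>))\<bar> \<le> \<epsilon> * real r)"
      proof eventually_elim
        case (elim r)
        show ?case
        proof (intro allI impI)
          fix x :: "nat ^ 'k" and n assume x: "total x = r" and n: "n \<le> T * r"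
          have a: "\<bar>(\<Sum>k<n. real (A (Suc k) \<omega> $ i)) - rate $ i * real n\<bar> \<le> \<epsilon> / 2 * real r"
            using elim(1) n by blast
          have "\<bar>departure_noise E A N i x n \<omega>\<bar> \<le> 1 / real (Suc l) * real r"
            using elim(2) x n by blast
          also have "\<dots> \<le> \<epsilon> / 2 * real r" using l by (intro mult_right_mono) auto
          finally have b: "\<bar>departure_noise E A N i x n \<omega>\<bar> \<le> \<epsilon> / 2 * real r" .
          have "real (users E A N x n \<omega> $ i) - real (x $ i) - rate $ i * real n
              + (\<Sum>m<n. success_prob E i (users E A N x m \<omega>))
            = ((\<Sum>k<n. real (A (Suc k) \<omega> $ i)) - rate $ i * real n) - departure_noise E A N i x n \<omega>"
            using users_eq[of N x \<omega> i E A n] \<open>\<forall>x n i. N x n \<omega> $ i \<le> users E A N x n \<omega> $ i\<close>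
            by (simp add: departure_noise_def sum_subtractf)
          with a b show "\<bar>real (users E A N x n \<omega> $ i) - real (x $ i) - rate $ i * real n
              + (\<Sum>m<n. success_prob E i (users E A N x m \<omega>))\<bar> \<le> \<epsilon> * real r"
            by linarith
        qed
      qed
    qed
  qed
qed

end

section \<open>Deterministic analysis of fluid paths\<close>

lemma le_of_le_add_small:
  fixes a b :: real
  assumes "0 \<le> c" and "\<And>\<epsilon>. 0 < \<epsilon> \<Longrightarrow> \<epsilon> \<le> \<delta> \<Longrightarrow> a \<le> b + c * \<epsilon>" and "0 < \<delta>"
  shows "a \<le> b"
proof (rule field_le_epsilon)
  fix e :: real assume "0 < e"
  define \<epsilon> where "\<epsilon> = min \<delta> (e / (c + 1))"
  have "0 < \<epsilon>" "\<epsilon> \<le> \<delta>" using assms \<open>0 < e\<close> by (auto simp: \<epsilon>_def)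
  moreover have "c * \<epsilon> \<le> e"
  proof -
    have "c * \<epsilon> \<le> c * (e / (c + 1))" using assms(1) by (intro mult_left_mono) (auto simp: \<epsilon>_def)
    also have "\<dots> \<le> (c + 1) * (e / (c + 1))" using assms(1) \<open>0 < e\<close> by (intro mult_right_mono) auto
    also have "\<dots> = e" using assms(1) by simp
    finally show ?thesis .
  qed
  ultimately show "a \<le> b + e" using assms(2)[of \<epsilon>] by linarith
qed

lemma time_changeD:
  assumes "time_change \<mu>"
  shows "0 \<le> s \<Longrightarrow> 0 \<le> \<mu> s" "0 \<le> s \<Longrightarrow> s \<le> s' \<Longrightarrow> \<mu> s \<le> \<mu> s'" "0 \<le> u \<Longrightarrow> \<exists>s\<ge>0. \<mu> s = u"
proof -
  show "0 \<le> s \<Longrightarrow> 0 \<le> \<mu> s" using assms by (auto simp: time_change_def bij_betw_def)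
  show "0 \<le> s \<Longrightarrow> s \<le> s' \<Longrightarrow> \<mu> s \<le> \<mu> s'"
    using assms by (cases "s = s'") (auto simp: time_change_def strict_mono_on_def intro: less_imp_le)
  show "0 \<le> u \<Longrightarrow> \<exists>s\<ge>0. \<mu> s = u"
    using assms unfolding time_change_def bij_betw_def by (metis atLeast_iff imageE)
qed

text \<open>The situation at one sample point: \<open>W n m\<close> is the state of the
  \<open>n\<close>-th chain after \<open>m\<close> slots, \<open>r n\<close> its scale, and
  \<open>p\<close> the compensator of the departures. Accumulation is expressed by basic
  neighbourhoods being hit frequently, which combines directly with what holds eventually.\<close>

locale fluid_path =
  fixes W :: "nat \<Rightarrow> nat \<Rightarrow> nat ^ 'k::finite" and r :: "nat \<Rightarrow> nat"
    and p :: "'k \<Rightarrow> nat ^ 'k \<Rightarrow> real" and \<Lambda> :: "'k \<Rightarrow> real" and z :: "real \<Rightarrow> real ^ 'k"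
  assumes r_at_top: "filterlim r at_top sequentially"
    and p_bounds: "\<And>i w. 0 \<le> p i w" "\<And>i w. p i w \<le> 1"
    and \<Lambda>_nonneg: "\<And>i. 0 \<le> \<Lambda> i"
    and drift: "\<And>i T \<epsilon>. 0 < \<epsilon> \<Longrightarrow> \<forall>\<^sub>F n in sequentially. \<forall>m\<le>T * r n.
      \<bar>real (W n m $ i) - real (W n 0 $ i) - \<Lambda> i * real m + (\<Sum>l<m. p i (W n l))\<bar> \<le> \<epsilon> * real (r n)"
    and accumulates: "\<And>T \<epsilon>. 0 < T \<Longrightarrow> 0 < \<epsilon> \<Longrightarrow> \<exists>\<^sub>F n in sequentially.
      (\<lambda>t. \<chi> i. real (W n (nat \<lceil>real (r n) * t\<rceil>) $ i) / real (r n)) \<in> skorokhod_nbhd z T \<epsilon>"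
begin

definition X :: "nat \<Rightarrow> real \<Rightarrow> 'k \<Rightarrow> real" where
  "X n t i = real (W n (nat \<lceil>real (r n) * t\<rceil>) $ i) / real (r n)"

text \<open>A Lipschitz constant common to all coordinates: coordinate \<open>i\<close> drifts at a
  rate between -1 and \<open>\<Lambda> i\<close>.\<close>

definition L :: real where "L = 1 + (\<Sum>i\<in>UNIV. \<Lambda> i)"

lemma L_ge: "\<Lambda> i + 1 \<le> L" and L_pos: "0 < L"
proof -
  have "\<Lambda> i \<le> (\<Sum>i\<in>UNIV. \<Lambda> i)" for i
    by (rule member_le_sum) (auto simp: \<Lambda>_nonneg)
  then show "\<Lambda> i + 1 \<le> L" by (simp add: L_def)
  show "0 < L" using sum_nonneg[of UNIV \<Lambda>] \<Lambda>_nonneg by (simp add: L_def)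
qed

text \<open>One \<open>n\<close> serves all intervals at once, because increments are differences of
  two drift estimates from time 0, which are uniform in the slot.\<close>

lemma eventually_increment:
  assumes "0 < \<epsilon>"
  shows "\<forall>\<^sub>F n in sequentially. 0 < r n \<and> 1 / real (r n) \<le> \<epsilon> \<and>
    (\<forall>i a b. 0 \<le> a \<longrightarrow> a \<le> b \<longrightarrow> b \<le> T \<longrightarrow>
      \<bar>X n b i - X n a i - \<Lambda> i * (b - a) +
         (\<Sum>l=nat \<lceil>real (r n) * a\<rceil>..<nat \<lceil>real (r n) * b\<rceil>. p i (W n l)) / real (r n)\<bar> \<le> \<epsilon>)"
proof -
  \<comment> \<open>The two endpoints cost \<open>\<epsilon>'\<close> each; rounding them up to
    whole slots costs at most \<open>\<Lambda> i / r n\<close>, which is at most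
    \<open>L * \<epsilon>'\<close>.\<close>
  define \<epsilon>' where "\<epsilon>' = \<epsilon> / (2 + L)"
  have \<epsilon>': "0 < \<epsilon>'" "(2 + L) * \<epsilon>' = \<epsilon>" using assms L_pos by (auto simp: \<epsilon>'_def)
  \<comment> \<open>The extra unit absorbs the rounding: the last slot is below
    \<open>r n * b + 1\<close>, and this is at most \<open>T' * r n\<close> because
    \<open>1 \<le> r n\<close>.\<close>
  define T' where "T' = nat \<lceil>T\<rceil> + 1"
  have "\<forall>\<^sub>F n in sequentially. \<forall>i. \<forall>m\<le>T' * r n.
      \<bar>real (W n m $ i) - real (W n 0 $ i) - \<Lambda> i * real m + (\<Sum>l<m. p i (W n l))\<bar> \<le> \<epsilon>' * real (r n)"
    using drift[OF \<epsilon>'(1)] by (intro eventually_all_finite) auto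
  moreover have "\<forall>\<^sub>F n in sequentially. max 1 (nat \<lceil>1 / \<epsilon>'\<rceil>) \<le> r n"
    using r_at_top unfolding filterlim_at_top by blast
  ultimately show ?thesis
  proof eventually_elim
    case (elim n)
    define R where "R = real (r n)"
    have R: "1 \<le> R" "1 / \<epsilon>' \<le> R" using elim(2) by (auto simp: R_def)
    then have R': "1 / R \<le> \<epsilon>'" using \<epsilon>'(1) by (simp add: field_simps)
    have "\<epsilon>' * 1 \<le> \<epsilon>' * (2 + L)" using \<epsilon>'(1) L_pos by (intro mult_left_mono) auto
    then have le: "\<epsilon>' \<le> \<epsilon>" unfolding \<epsilon>'(2)[symmetric] by (simp only: mult.commute mult_1_left)
    have main: "\<bar>X n b i - X n a i - \<Lambda> i * (b - a) +
         (\<Sum>l=nat \<lceil>R * a\<rceil>..<nat \<lceil>R * b\<rceil>. p i (W n l)) / R\<bar> \<le> \<epsilon>"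
      if ab: "0 \<le> a" "a \<le> b" "b \<le> T" for a b i
    proof -
      define m where "m = nat \<lceil>R * a\<rceil>"
      define m' where "m' = nat \<lceil>R * b\<rceil>"
      have ra: "0 \<le> R * a" "R * a \<le> R * b" using ab R by (auto intro: mult_left_mono)
      have m: "R * a \<le> real m" "real m < R * a + 1"
        using ra ceiling_correct[of "R * a"] by (auto simp: m_def of_nat_nat)
      have m': "R * b \<le> real m'" "real m' < R * b + 1"
        using ra ceiling_correct[of "R * b"] by (auto simp: m'_def of_nat_nat)
      have mm: "m \<le> m'" unfolding m_def m'_def using ra by (intro nat_mono ceiling_mono)
      have "R * b + 1 \<le> R * real T'"
      proof -
        have "b \<le> real (nat \<lceil>T\<rceil>)" using ab(3) real_nat_ceiling_ge[of T] by linarith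
        then have "R * b \<le> R * real (nat \<lceil>T\<rceil>)" using R by (intro mult_left_mono) auto
        then show ?thesis
          using R unfolding T'_def by (simp only: of_nat_add of_nat_1 distrib_left)
      qed
      then have "real m' \<le> real (T' * r n)" using m' by (simp add: R_def mult.commute)
      then have m'T: "m' \<le> T' * r n" by linarith
      then have mT: "m \<le> T' * r n" using mm by linarith
      have sum: "(\<Sum>l<m'. p i (W n l)) = (\<Sum>l<m. p i (W n l)) + (\<Sum>l=m..<m'. p i (W n l))"
        using mm by (metis sum.atLeastLessThan_concat atLeast0LessThan le0)
      define D where "D = real (W n m' $ i) - real (W n m $ i) - \<Lambda> i * (real m' - real m)
          + (\<Sum>l=m..<m'. p i (W n l))"
      have "\<bar>D\<bar> \<le> 2 * \<epsilon>' * R"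
        using elim(1)[rule_format, OF mT, of i] elim(1)[rule_format, OF m'T, of i]
        unfolding sum D_def R_def by (simp add: algebra_simps abs_le_iff)
      then have D: "\<bar>D / R\<bar> \<le> 2 * \<epsilon>'" using R by (simp add: abs_divide divide_le_eq)
      have "X n b i - X n a i - \<Lambda> i * (b - a) + (\<Sum>l=m..<m'. p i (W n l)) / R
          = D / R + \<Lambda> i * (((real m' - R * b) - (real m - R * a)) / R)"
        using R by (simp add: X_def D_def R_def[symmetric] m_def[symmetric] m'_def[symmetric] field_simps)
      also have "\<bar>\<dots>\<bar> \<le> \<bar>D / R\<bar> + \<Lambda> i * (1 / R)"
      proof -
        have "\<bar>((real m' - R * b) - (real m - R * a)) / R\<bar> \<le> 1 / R"
          using m m' R by (simp add: abs_divide divide_right_mono)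
        then have "\<bar>\<Lambda> i * (((real m' - R * b) - (real m - R * a)) / R)\<bar> \<le> \<Lambda> i * (1 / R)"
          by (simp only: abs_mult abs_of_nonneg[OF \<Lambda>_nonneg] mult_left_mono[OF _ \<Lambda>_nonneg])
        then show ?thesis by linarith
      qed
      also have "\<Lambda> i * (1 / R) \<le> L * \<epsilon>'"
        using R R' L_ge[of i] \<Lambda>_nonneg[of i] \<epsilon>' by (intro mult_mono) auto
      finally show ?thesis using D \<epsilon>'(2) by (simp add: m_def m'_def algebra_simps)
    qed
    show ?case using main R R' le by (auto simp: R_def)
  qed
qed

lemma skorokhod_nbhdD:
  assumes "(\<lambda>t. \<chi> i. real (W n (nat \<lceil>real (r n) * t\<rceil>) $ i) / real (r n)) \<in> skorokhod_nbhd z T \<epsilon>"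
  shows "\<exists>\<mu>. time_change \<mu> \<and> (\<forall>s\<ge>0. \<bar>\<mu> s - s\<bar> \<le> \<epsilon>) \<and>
    (\<forall>s\<in>{0..T}. \<forall>i. \<bar>X n (\<mu> s) i - z s $ i\<bar> \<le> \<epsilon>)"
proof -
  obtain \<mu> \<delta> where \<mu>: "time_change \<mu>" "\<delta> < \<epsilon>" "\<forall>s\<ge>0. \<bar>\<mu> s - s\<bar> \<le> \<delta>"
      "\<forall>s\<in>{0..T}. dist ((\<chi> i. real (W n (nat \<lceil>real (r n) * \<mu> s\<rceil>) $ i) / real (r n)) :: real ^ 'k) (z s) \<le> \<delta>"
    using assms unfolding skorokhod_nbhd_def by blast
  have "\<bar>X n (\<mu> s) i - z s $ i\<bar> \<le> \<epsilon>" if "s \<in> {0..T}" for s i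
    using dist_vec_nth_le[of "(\<chi> i. real (W n (nat \<lceil>real (r n) * \<mu> s\<rceil>) $ i) / real (r n)) :: real ^ 'k" i "z s"]
      \<mu>(2) \<mu>(4)[rule_format, OF that]
    by (simp add: X_def dist_real_def)
  with \<mu> show ?thesis by (intro exI[of _ \<mu>]) (auto intro: order_trans less_imp_le)
qed

text \<open>The compensator is at most 1 per slot, and rounding adds at most one slot, hence the
  term \<open>1 / r n\<close>.\<close>

lemma departures_bound:
  assumes "0 \<le> a" "a \<le> b" "0 < r n"
  shows "\<bar>\<Lambda> i * (b - a) - (\<Sum>l=nat \<lceil>real (r n) * a\<rceil>..<nat \<lceil>real (r n) * b\<rceil>. p i (W n l)) / real (r n)\<bar>
    \<le> L * (b - a) + 1 / real (r n)"
proof -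
  define R where "R = real (r n)"
  have R: "0 < R" using assms by (simp add: R_def)
  define S where "S = (\<Sum>l=nat \<lceil>R * a\<rceil>..<nat \<lceil>R * b\<rceil>. p i (W n l))"
  have ra: "0 \<le> R * a" "R * a \<le> R * b" using assms R by (auto intro: mult_left_mono)
  have mm: "nat \<lceil>R * a\<rceil> \<le> nat \<lceil>R * b\<rceil>" using ra by (intro nat_mono ceiling_mono)
  have "0 \<le> S" unfolding S_def by (intro sum_nonneg p_bounds)
  have "S \<le> (\<Sum>l=nat \<lceil>R * a\<rceil>..<nat \<lceil>R * b\<rceil>. 1)" unfolding S_def by (intro sum_mono p_bounds)
  also have "\<dots> = real (nat \<lceil>R * b\<rceil>) - real (nat \<lceil>R * a\<rceil>)"
    by (simp only: sum_constant card_atLeastLessThan of_nat_diff[OF mm] mult_1_right)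
  also have "\<dots> \<le> R * (b - a) + 1"
  proof -
    have "R * a \<le> real (nat \<lceil>R * a\<rceil>)" by (rule real_nat_ceiling_ge)
    moreover have "real (nat \<lceil>R * b\<rceil>) \<le> R * b + 1"
      using ra ceiling_correct[of "R * b"] by (simp add: of_nat_nat)
    ultimately show ?thesis by (simp only: right_diff_distrib)
  qed
  finally have S: "0 \<le> S / R" "S / R \<le> (b - a) + 1 / R"
    using \<open>0 \<le> S\<close> R by (auto simp: field_simps)
  have "0 \<le> \<Lambda> i * (b - a)" using \<Lambda>_nonneg assms by simp
  moreover have "\<Lambda> i * (b - a) + (b - a) \<le> L * (b - a)"
    using mult_right_mono[OF L_ge[of i], of "b - a"] assms by (simp add: algebra_simps)
  moreover have "0 \<le> 1 / R" using R by simp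
  ultimately have "\<bar>\<Lambda> i * (b - a) - S / R\<bar> \<le> L * (b - a) + 1 / R" using S assms(2) by linarith
  then show ?thesis by (simp add: S_def R_def)
qed

text \<open>Continuity of \<open>z\<close> is a conclusion here, so the rescaled chain is read at
  the shifted times \<open>\<mu> s\<close> and \<open>\<mu> s'\<close>, where Skorokhod closeness
  compares it with \<open>z\<close> directly. The distance of these times exceeds
  \<open>s' - s\<close> by at most \<open>2 * \<epsilon>\<close>.\<close>

lemma lipschitz:
  assumes "0 \<le> s" "s \<le> s'"
  shows "\<bar>z s' $ i - z s $ i\<bar> \<le> L * (s' - s)"
proof (rule le_of_le_add_small[where \<delta> = 1 and c = "2 * L + 4"])
  fix \<epsilon> :: real assume \<epsilon>: "0 < \<epsilon>" "\<epsilon> \<le> 1"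
  \<comment> \<open>The longer horizon leaves room for \<open>\<mu> s'\<close> and is positive even
    if \<open>s' = 0\<close>.\<close>
  have "\<exists>\<^sub>F n in sequentially.
      (\<lambda>t. \<chi> i. real (W n (nat \<lceil>real (r n) * t\<rceil>) $ i) / real (r n)) \<in> skorokhod_nbhd z (s' + 1) \<epsilon>"
    using assms \<epsilon> by (intro accumulates) auto
  from frequently_ex[OF frequently_eventually_frequently[OF this
      eventually_increment[OF \<epsilon>(1), of "s' + 1"]]]
  obtain n where n: "(\<lambda>t. \<chi> i. real (W n (nat \<lceil>real (r n) * t\<rceil>) $ i) / real (r n)) \<in> skorokhod_nbhd z (s' + 1) \<epsilon>"
      "0 < r n" "1 / real (r n) \<le> \<epsilon>"
      "\<And>i a b. 0 \<le> a \<Longrightarrow> a \<le> b \<Longrightarrow> b \<le> s' + 1 \<Longrightarrow>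
      \<bar>X n b i - X n a i - \<Lambda> i * (b - a) +
         (\<Sum>l=nat \<lceil>real (r n) * a\<rceil>..<nat \<lceil>real (r n) * b\<rceil>. p i (W n l)) / real (r n)\<bar> \<le> \<epsilon>"
    by blast
  obtain \<mu> where \<mu>: "time_change \<mu>" "\<And>s. 0 \<le> s \<Longrightarrow> \<bar>\<mu> s - s\<bar> \<le> \<epsilon>"
      "\<And>s i. s \<in> {0..s' + 1} \<Longrightarrow> \<bar>X n (\<mu> s) i - z s $ i\<bar> \<le> \<epsilon>"
    using skorokhod_nbhdD[OF n(1)] by blast
  have m: "0 \<le> \<mu> s" "\<mu> s \<le> \<mu> s'" "\<mu> s' \<le> s' + 1" "\<mu> s' - \<mu> s \<le> s' - s + 2 * \<epsilon>"
    using time_changeD[OF \<mu>(1)] assms \<mu>(2)[of s] \<mu>(2)[of s'] \<epsilon> by (auto simp: abs_le_iff)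
  \<comment> \<open>Two of the three errors come from the endpoints and one from the drift estimate;
    the fourth is \<open>1 / r n\<close> from \<open>departures_bound\<close>.\<close>
  have "\<bar>z s' $ i - z s $ i\<bar> \<le> 3 * \<epsilon> + (L * (\<mu> s' - \<mu> s) + \<epsilon>)"
    using \<mu>(3)[of s i] \<mu>(3)[of s' i] assms n(3) n(4)[OF m(1-3), of i]
      departures_bound[OF m(1,2) n(2), of i]
    by (simp add: abs_le_iff)
  also have "\<dots> \<le> 3 * \<epsilon> + (L * (s' - s + 2 * \<epsilon>) + \<epsilon>)"
    using m(4) L_pos by (intro add_mono mult_left_mono) auto
  finally show "\<bar>z s' $ i - z s $ i\<bar> \<le> L * (s' - s) + (2 * L + 4) * \<epsilon>"
    by (simp add: algebra_simps)
qed (use L_pos in auto)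

lemma lipschitz_abs:
  assumes "0 \<le> s" "0 \<le> s'"
  shows "\<bar>z s' $ i - z s $ i\<bar> \<le> L * \<bar>s' - s\<bar>"
  using lipschitz[of s s' i] lipschitz[of s' s i] assms by (cases "s \<le> s'") (auto simp: abs_minus_commute)

text \<open>Against a Lipschitz limit the time change can be undone: for \<open>\<mu> s = u\<close>
  the value \<open>X n u\<close> is within \<open>\<delta>\<close> of \<open>z s\<close>, and
  \<open>z s\<close> within \<open>L * \<delta>\<close> of \<open>z u\<close>. Surjectivity of
  \<open>\<mu>\<close> reaches every \<open>u\<close>.\<close>

lemma frequently_uniformly_close:
  assumes "0 < \<epsilon>" "0 \<le> T"
  shows "\<exists>\<^sub>F n in sequentially. \<forall>u\<in>{0..T}. \<forall>i. \<bar>X n u i - z u $ i\<bar> \<le> \<epsilon>"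
proof -
  define \<delta> where "\<delta> = min 1 (\<epsilon> / (1 + L))"
  have \<delta>: "0 < \<delta>" "\<delta> \<le> 1" using assms L_pos by (auto simp: \<delta>_def)
  have "(1 + L) * \<delta> \<le> (1 + L) * (\<epsilon> / (1 + L))"
    using L_pos by (intro mult_left_mono) (auto simp: \<delta>_def)
  then have \<delta>': "(1 + L) * \<delta> \<le> \<epsilon>" using L_pos by simp
  have "\<exists>\<^sub>F n in sequentially.
      (\<lambda>t. \<chi> i. real (W n (nat \<lceil>real (r n) * t\<rceil>) $ i) / real (r n)) \<in> skorokhod_nbhd z (T + 1) \<delta>"
    using assms \<delta> by (intro accumulates) auto
  then show ?thesis
  proof (rule frequently_elim1)
    fix n
    assume "(\<lambda>t. \<chi> i. real (W n (nat \<lceil>real (r n) * t\<rceil>) $ i) / real (r n)) \<in> skorokhod_nbhd z (T + 1) \<delta>"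
    from skorokhod_nbhdD[OF this]
    obtain \<mu> where \<mu>: "time_change \<mu>" "\<And>s. 0 \<le> s \<Longrightarrow> \<bar>\<mu> s - s\<bar> \<le> \<delta>"
      "\<And>s i. s \<in> {0..T + 1} \<Longrightarrow> \<bar>X n (\<mu> s) i - z s $ i\<bar> \<le> \<delta>"
      by blast
    show "\<forall>u\<in>{0..T}. \<forall>i. \<bar>X n u i - z u $ i\<bar> \<le> \<epsilon>"
    proof (intro ballI allI)
      fix u i assume u: "u \<in> {0..T}"
      then obtain s where s: "0 \<le> s" "\<mu> s = u" using time_changeD(3)[OF \<mu>(1)] by auto
      have d: "\<bar>u - s\<bar> \<le> \<delta>" using \<mu>(2)[OF s(1)] s by simp
      then have "s \<in> {0..T + 1}" using u s \<delta> by (auto simp: abs_le_iff)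
      then have "\<bar>X n u i - z s $ i\<bar> \<le> \<delta>" using \<mu>(3) s by blast
      moreover have "\<bar>z u $ i - z s $ i\<bar> \<le> L * \<delta>"
        using order_trans[OF lipschitz_abs[of s u i] mult_left_mono[OF d, of L]] s u L_pos by auto
      ultimately show "\<bar>X n u i - z u $ i\<bar> \<le> \<epsilon>" using \<delta>' by (simp add: algebra_simps)
    qed
  qed
qed

text \<open>Within time \<open>h\<close> of \<open>t\<close> the path moves by at most
  \<open>\<rho> / 2\<close> and the chain follows it up to another \<open>\<rho> / 2\<close>, so in
  every slot of the window the compensator is \<open>P\<close> up to \<open>\<eta>\<close>. Leaving
  both \<open>s\<close> and \<open>s'\<close> free covers difference quotients from either side of
  \<open>t\<close>.\<close>

lemma increment_near:
  assumes t: "0 \<le> t" and h: "0 < h" and L: "L * h \<le> \<rho> / 2" and \<rho>: "0 < \<rho>" and \<eta>: "0 < \<eta>"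
    and near: "\<And>w n. r0 \<le> n \<Longrightarrow> (\<And>j. \<bar>real (w $ j) / real n - z t $ j\<bar> \<le> \<rho>) \<Longrightarrow> \<bar>p i w - P\<bar> \<le> \<eta>"
    and s: "0 \<le> s" "s \<le> s'" "\<bar>s - t\<bar> \<le> h" "\<bar>s' - t\<bar> \<le> h"
  shows "\<bar>z s' $ i - z s $ i - (\<Lambda> i - P) * (s' - s)\<bar> \<le> \<eta> * (s' - s)"
proof (rule le_of_le_add_small[where \<delta> = "\<rho> / 2" and c = "3 + \<bar>P\<bar> + \<eta>"])
  fix \<epsilon> :: real assume \<epsilon>: "0 < \<epsilon>" "\<epsilon> \<le> \<rho> / 2"
  have ev: "\<forall>\<^sub>F n in sequentially. r0 \<le> r n" using r_at_top by (auto simp: filterlim_at_top)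
  have fr: "\<exists>\<^sub>F n in sequentially. \<forall>u\<in>{0..s'}. \<forall>i. \<bar>X n u i - z u $ i\<bar> \<le> \<epsilon>"
    using s \<epsilon> by (intro frequently_uniformly_close) auto
  from frequently_ex[OF frequently_eventually_frequently[OF frequently_eventually_frequently[OF fr ev]
      eventually_increment[OF \<epsilon>(1), of "s'"]]]
  obtain n where n: "\<And>u i. u \<in> {0..s'} \<Longrightarrow> \<bar>X n u i - z u $ i\<bar> \<le> \<epsilon>" "r0 \<le> r n"
      "0 < r n" "1 / real (r n) \<le> \<epsilon>"
      "\<bar>X n s' i - X n s i - \<Lambda> i * (s' - s) +
         (\<Sum>l=nat \<lceil>real (r n) * s\<rceil>..<nat \<lceil>real (r n) * s'\<rceil>. p i (W n l)) / real (r n)\<bar> \<le> \<epsilon>"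
    using s by blast
  define R where "R = real (r n)"
  have R: "0 < R" "1 / R \<le> \<epsilon>" using n by (auto simp: R_def)
  define m where "m = nat \<lceil>R * s\<rceil>"
  define m' where "m' = nat \<lceil>R * s'\<rceil>"
  have ra: "0 \<le> R * s" "R * s \<le> R * s'" using s R by (auto intro: mult_left_mono)
  have m: "R * s \<le> real m" "real m < R * s + 1"
    using ra ceiling_correct[of "R * s"] by (auto simp: m_def of_nat_nat)
  have m': "R * s' \<le> real m'" "real m' < R * s' + 1"
    using ra ceiling_correct[of "R * s'"] by (auto simp: m'_def of_nat_nat)
  have mm: "m \<le> m'" unfolding m_def m'_def using ra by (intro nat_mono ceiling_mono)
  \<comment> \<open>A slot \<open>l < \<lceil>R * s'\<rceil>\<close> satisfies
    \<open>l < R * s'\<close>, so \<open>u = l / R\<close> lies in the window, and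
    \<open>\<lceil>R * u\<rceil> = l\<close> makes \<open>X n u\<close> exactly the rescaled state
    of that slot.\<close>
  have pP: "\<bar>p i (W n l) - P\<bar> \<le> \<eta>" if l: "l \<in> {m..<m'}" for l
  proof (rule near[OF n(2)])
    fix j
    define u where "u = real l / R"
    have "real l < R * s'"
    proof -
      have "int l < \<lceil>R * s'\<rceil>" using l by (auto simp: m'_def)
      then show ?thesis by (simp add: less_ceiling_iff)
    qed
    moreover have "R * s \<le> real l" using m(1) l by auto
    ultimately have u: "s \<le> u" "u \<le> s'" using R by (auto simp: u_def field_simps)
    have "X n u j = real (W n l $ j) / R" using R by (simp add: X_def u_def R_def[symmetric])
    moreover have "\<bar>X n u j - z u $ j\<bar> \<le> \<epsilon>" using u s by (intro n) auto
    moreover have "\<bar>z u $ j - z t $ j\<bar> \<le> \<rho> / 2"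
    proof -
      have "\<bar>u - t\<bar> \<le> h" using u s by (auto simp: abs_le_iff)
      then have "L * \<bar>u - t\<bar> \<le> L * h" using L_pos by (intro mult_left_mono) auto
      then show ?thesis using lipschitz_abs[of t u j] t s u L by simp
    qed
    ultimately show "\<bar>real (W n l $ j) / real (r n) - z t $ j\<bar> \<le> \<rho>"
      using \<epsilon>(2) unfolding R_def by linarith
  qed
  define S where "S = (\<Sum>l=m..<m'. p i (W n l))"
  have len: "\<bar>(real m' - real m) / R - (s' - s)\<bar> \<le> 1 / R"
  proof -
    have "(real m' - real m) / R - (s' - s) = ((real m' - R * s') - (real m - R * s)) / R"
      using R by (simp add: field_simps)
    then show ?thesis using m m' R by (simp add: abs_divide divide_right_mono)
  qed
  have "\<bar>S - P * (real m' - real m)\<bar> \<le> \<eta> * (real m' - real m)"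
  proof -
    have "S - P * (real m' - real m) = (\<Sum>l=m..<m'. p i (W n l) - P)"
      using mm by (simp add: S_def sum_subtractf of_nat_diff)
    also have "\<bar>\<dots>\<bar> \<le> (\<Sum>l=m..<m'. \<eta>)"
      using pP by (intro order_trans[OF sum_abs] sum_mono) auto
    finally show ?thesis using mm by (simp add: of_nat_diff mult.commute)
  qed
  then have SR: "\<bar>S / R - P * ((real m' - real m) / R)\<bar> \<le> \<eta> * ((real m' - real m) / R)"
  proof -
    have "S / R - P * ((real m' - real m) / R) = (S - P * (real m' - real m)) / R"
      using R by (simp add: field_simps)
    with \<open>\<bar>S - P * (real m' - real m)\<bar> \<le> \<eta> * (real m' - real m)\<close> R show ?thesis
      by (simp add: abs_divide divide_right_mono)
  qed
  have e1: "\<eta> * ((real m' - real m) / R) \<le> \<eta> * (s' - s) + \<eta> * \<epsilon>"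
  proof -
    have "(real m' - real m) / R \<le> (s' - s) + \<epsilon>" using len R by (simp add: abs_le_iff)
    from mult_left_mono[OF this, of \<eta>] show ?thesis using \<eta> by (simp add: algebra_simps)
  qed
  have e2: "\<bar>P * ((real m' - real m) / R) - P * (s' - s)\<bar> \<le> \<bar>P\<bar> * \<epsilon>"
  proof -
    have "P * ((real m' - real m) / R) - P * (s' - s) = P * ((real m' - real m) / R - (s' - s))"
      by (simp add: algebra_simps)
    then show ?thesis using len R by (simp add: abs_mult mult_left_mono)
  qed
  have e3: "\<bar>X n s' i - X n s i - \<Lambda> i * (s' - s) + S / R\<bar> \<le> \<epsilon>"
    using n(5) by (simp add: S_def R_def m_def m'_def)
  have e4: "\<bar>X n s' i - z s' $ i\<bar> \<le> \<epsilon>" "\<bar>X n s i - z s $ i\<bar> \<le> \<epsilon>"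
    using s by (auto intro: n)
  \<comment> \<open>The drift estimate and the two endpoints give \<open>3 * \<epsilon>\<close>; the
    terms \<open>\<bar>P\<bar> * \<epsilon>\<close> and \<open>\<eta> * \<epsilon>\<close> come from
    replacing the number of slots over \<open>R\<close> by \<open>s' - s\<close>.\<close>
  have "\<bar>z s' $ i - z s $ i - (\<Lambda> i * (s' - s) - P * (s' - s))\<bar>
      \<le> 3 * \<epsilon> + \<bar>P\<bar> * \<epsilon> + (\<eta> * (s' - s) + \<eta> * \<epsilon>)"
    using e1 e2 e3 e4 SR by linarith
  then show "\<bar>z s' $ i - z s $ i - (\<Lambda> i - P) * (s' - s)\<bar> \<le> \<eta> * (s' - s) + (3 + \<bar>P\<bar> + \<eta>) * \<epsilon>"
    by (simp add: algebra_simps)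
qed (use \<rho> \<eta> in auto)

text \<open>The filter \<open>at t within {0..}\<close> treats interior points and the right
  derivative at 0 together.\<close>

lemma has_derivative_near:
  assumes t: "0 \<le> t"
    and near: "\<And>\<eta>. 0 < \<eta> \<Longrightarrow> \<exists>\<rho>>0. \<exists>r0. \<forall>n\<ge>r0. \<forall>w.
        (\<forall>j. \<bar>real (w $ j) / real n - z t $ j\<bar> \<le> \<rho>) \<longrightarrow> \<bar>p i w - P\<bar> \<le> \<eta>"
  shows "((\<lambda>s. z s $ i) has_real_derivative \<Lambda> i - P) (at t within {0..})"
  unfolding has_field_derivative_iff
proof (rule tendstoI)
  fix e :: real assume "0 < e"
  define \<eta> where "\<eta> = e / 2"
  have \<eta>: "0 < \<eta>" "\<eta> < e" using \<open>0 < e\<close> by (auto simp: \<eta>_def)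
  obtain \<rho> r0 where \<rho>: "0 < \<rho>" and near': "\<And>w n. r0 \<le> n \<Longrightarrow>
      (\<And>j. \<bar>real (w $ j) / real n - z t $ j\<bar> \<le> \<rho>) \<Longrightarrow> \<bar>p i w - P\<bar> \<le> \<eta>"
    using near[OF \<eta>(1)] by blast
  define h where "h = \<rho> / (2 * L)"
  have h: "0 < h" "L * h \<le> \<rho> / 2" using \<rho> L_pos by (auto simp: h_def)
  have inc: "\<bar>z s' $ i - z s $ i - (\<Lambda> i - P) * (s' - s)\<bar> \<le> \<eta> * (s' - s)"
    if "0 \<le> s" "s \<le> s'" "\<bar>s - t\<bar> \<le> h" "\<bar>s' - t\<bar> \<le> h" for s s'
    by (rule increment_near[OF t h \<rho> \<eta>(1), of r0]) (use near' that in auto)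
  have "dist ((z y $ i - z t $ i) / (y - t)) (\<Lambda> i - P) < e"
    if y: "y \<in> {0..}" "y \<noteq> t" "dist y t < h" for y
  proof -
    have "\<bar>z y $ i - z t $ i - (\<Lambda> i - P) * (y - t)\<bar> \<le> \<eta> * \<bar>y - t\<bar>"
    proof (cases "t \<le> y")
      case True
      then show ?thesis
        using inc[of t y] t y h by (simp add: dist_real_def)
    next
      case False
      then have "\<bar>z t $ i - z y $ i - (\<Lambda> i - P) * (t - y)\<bar> \<le> \<eta> * (t - y)"
        using y h by (intro inc) (auto simp: dist_real_def)
      with False show ?thesis by (simp add: abs_le_iff algebra_simps)
    qed
    then have "\<bar>z y $ i - z t $ i - (\<Lambda> i - P) * (y - t)\<bar> / \<bar>y - t\<bar> \<le> \<eta>"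
      using y by (simp add: divide_le_eq)
    moreover have "(z y $ i - z t $ i) / (y - t) - (\<Lambda> i - P)
        = (z y $ i - z t $ i - (\<Lambda> i - P) * (y - t)) / (y - t)"
      using y by (simp add: field_simps)
    ultimately show ?thesis using \<eta> by (simp add: dist_real_def abs_divide)
  qed
  then show "\<forall>\<^sub>F y in at t within {0..}. dist ((z y $ i - z t $ i) / (y - t)) (\<Lambda> i - P) < e"
    using h(1) unfolding eventually_at by blast
qed

end

theorem theorem3:
  fixes M :: "'w measure" and E :: "('k::finite \<times> 'k) set"
    and A :: "nat \<Rightarrow> 'w \<Rightarrow> nat ^ 'k" and N :: "nat ^ 'k \<Rightarrow> nat \<Rightarrow> 'w \<Rightarrow> nat ^ 'k"
    and rate :: "real ^ 'k" and z :: "'w \<Rightarrow> real \<Rightarrow> real ^ 'k" and t :: real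
  assumes "random_access_model M E A N rate"
    and "fluid_limit M E A N z"
    and "0 \<le> t"
  shows "AE \<omega> in M. (\<forall>i. 0 < (\<Sum>j\<in>nbhd E i. z \<omega> t $ j)) \<longrightarrow>
    (\<forall>i. ((\<lambda>s. z \<omega> s $ i) has_real_derivative
            (rate $ i - local_share E (z \<omega> t) i * exp (- (\<Sum>j\<in>nbhd E i. local_share E (z \<omega> t) j))))
          (if t = 0 then at_right 0 else at t))"
proof -
  interpret random_access_model M E A N rate by fact
  obtain x :: "nat \<Rightarrow> nat ^ 'k" where x: "filterlim (\<lambda>n. total (x n)) at_top sequentially"
      and acc: "AE \<omega> in M. cadlag (z \<omega>) \<and>
        accumulation_point skorokhod_topology (\<lambda>n. rescaled E A N (x n) \<omega>) (z \<omega>)"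
    using assms(2) unfolding fluid_limit_def by blast
  \<comment> \<open>The exceptional null set comes from the drift estimate and the accumulation
    property alone, so it is the same for every \<open>t\<close>.\<close>
  show ?thesis
    using AE_drift acc
  proof eventually_elim
    case (elim \<omega>)
    interpret fluid_path "\<lambda>n m. users E A N (x n) m \<omega>" "\<lambda>n. total (x n)" "success_prob E"
        "vec_nth rate" "z \<omega>"
    proof
      show "filterlim (\<lambda>n. total (x n)) at_top sequentially" by (rule x)
      show "0 \<le> success_prob E i w" "success_prob E i w \<le> 1" for i w
        by (rule success_prob_bounds)+
      show "0 \<le> rate $ i" for i using rates_pos[of i] by simp
      show "\<forall>\<^sub>F n in sequentially. \<forall>m\<le>T * total (x n).
          \<bar>real (users E A N (x n) m \<omega> $ i) - real (users E A N (x n) 0 \<omega> $ i) - rate $ i * real m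
            + (\<Sum>l<m. success_prob E i (users E A N (x n) l \<omega>))\<bar> \<le> \<epsilon> * real (total (x n))"
        if "0 < \<epsilon>" for i T \<epsilon>
      proof -
        have "\<forall>\<^sub>F r in sequentially. \<forall>y. total y = r \<longrightarrow> (\<forall>n\<le>T * r.
            \<bar>real (users E A N y n \<omega> $ i) - real (y $ i) - rate $ i * real n
              + (\<Sum>m<n. success_prob E i (users E A N y m \<omega>))\<bar> \<le> \<epsilon> * real r)"
          using elim(1) that by blast
        \<comment> \<open>Uniformity over all \<open>y\<close> of mass \<open>r\<close> permits
          \<open>y = x n\<close> with \<open>r = total (x n)\<close>, even if masses repeat along
          the sequence.\<close>
        from eventually_compose_filterlim[OF this x] show ?thesis
          by eventually_elim simp
      qed
      show "\<exists>\<^sub>F n in sequentially. (\<lambda>t. \<chi> i. real (users E A N (x n) (nat \<lceil>real (total (x n)) * t\<rceil>) \<omega> $ i)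
          / real (total (x n))) \<in> skorokhod_nbhd (z \<omega>) T \<epsilon>"
        if "0 < T" "0 < \<epsilon>" for T \<epsilon>
      proof -
        have "openin skorokhod_topology (skorokhod_nbhd (z \<omega>) T \<epsilon>)"
          unfolding skorokhod_topology_def using that by (intro topology_generated_by_Basis) blast
        then have "\<exists>\<^sub>F n in sequentially. rescaled E A N (x n) \<omega> \<in> skorokhod_nbhd (z \<omega>) T \<epsilon>"
          using elim(2) skorokhod_nbhd_self[OF that(2)] unfolding accumulation_point_def by blast
        then show ?thesis unfolding rescaled_def .
      qed
    qed
    show ?case
    proof (intro impI allI)
      fix i assume "\<forall>i. 0 < (\<Sum>j\<in>nbhd E i. z \<omega> t $ j)"
      then have deriv: "((\<lambda>s. z \<omega> s $ i) has_real_derivative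
            (rate $ i - local_share E (z \<omega> t) i * exp (- (\<Sum>j\<in>nbhd E i. local_share E (z \<omega> t) j))))
          (at t within {0..})"
        by (intro has_derivative_near[OF assms(3)] success_prob_near) auto
      show "((\<lambda>s. z \<omega> s $ i) has_real_derivative
            (rate $ i - local_share E (z \<omega> t) i * exp (- (\<Sum>j\<in>nbhd E i. local_share E (z \<omega> t) j))))
          (if t = 0 then at_right 0 else at t)"
      proof (cases "t = 0")
        case True
        have "{0<..} \<subseteq> {0 :: real..}" by auto
        from DERIV_subset[OF deriv this] True show ?thesis by simp
      next
        case False
        then have "at t within {0..} = at t"
          using assms(3) by (intro at_within_interior) simp
        with deriv False show ?thesis by simp
      qed
    qed
  qed
qed

end
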